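(* (1) Let $K$ be a classical knot diagram. Then $\{K\}=2A^{w(K)}$, where $w(K)$ is the writhe of $K$ (independent of the choice of orientation of $K$). Thus $Inv(K)=2$. (2) Let $L$ be a classical link diagram. Then $$\{L\}=\sum_{O\in O(L)}A^{w(L^O)},$$ where $O(L)$ denotes the set of orientations of $L$ and $L^O$ denotes $L$ with the orientation $O$. Thus, for a given orientation $O_0$ of $L$, $$Inv(L^{O_0})=\sum_{O\in O(L)}A^{w(L^O)-w(L^{O_0})}.$$ Moreover, if $L$ has components $L_1,\dots,L_N$, then $$w(L^O)-w(L^{O_0})=2\sum_{i<j}\bigl(Lk(L^O_i,L^O_j)-Lk(L^{O_0}_i,L^{O_0}_j)\bigr),$$ where $Lk$ denotes the linking number.
   Context: A classical link diagram is a link diagram in the plane all of whose crossings are ordinary over/under crossings. An orientation of a link diagram is a choice of direction on each component, so $O(L)$ has $2^N$ elements if $L$ has $N$ components. The writhe $w$ of an oriented diagram is the sum of the signs ($\pm1$, usual right-handed convention) of its crossings. The linking number $Lk$ of two components is half the sum of the signs of the crossings between them. Binary bracket: let $K$ be an unoriented link diagram. Each crossing has two smoothings. The $A$-smoothing joins the two regions (locally) swept out when the overcrossing line is rotated counterclockwise until it meets the undercrossing line; it gets vertex weight $A$. The other smoothing gets vertex weight $A^{-1}$. (Thus at a positive crossing the orientation-respecting smoothing has weight $A$, and at a negative crossing it has weight $A^{-1}$.) A state is a choice of smoothing at every crossing, giving a collection of loops. A labeled state is a state with a label $0$ or $1$ assigned to each loop. It is properly labeled if at each smoothed crossing the two arcs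 of the smoothing carry distinct labels. For a properly labeled state $S$, $\{K|S\}$ is the product of its vertex weights, and $\{K\}=\sum_S\{K|S\}\in\mathbb{Z}[A,A^{-1}]$, summed over all properly labeled states $S$ of $K$. For an oriented diagram $K$, $Inv(K)=A^{-w(K)}\{K\}$, the binary bracket being computed from the underlying unoriented diagram. *)

theory Defs
  imports "HOL-Analysis.Analysis" "HOL-Library.Poly_Mapping" "HOL-Library.FuncSet"
begin

section \<open>Classical link diagrams\<close>

text \<open>
  The plane is \<^typ>\<open>complex\<close>. Each component is a closed curve, given as a map on the real line of
  period 1. A passage of the diagram through a point of the plane (a strand) is a pair of a component
  and a parameter in the half-open unit interval. The third field selects, at each crossing, the
  overcrossing strand; its values elsewhere are irrelevant. The parametrization of a component also
  serves as its reference direction, but it is not an orientation of the diagram.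
\<close>

record link_diagram =
  ncomp :: nat
  curve :: "nat \<Rightarrow> real \<Rightarrow> complex"
  over :: "complex \<Rightarrow> nat \<times> real"

definition strands :: "link_diagram \<Rightarrow> complex \<Rightarrow> (nat \<times> real) set" where
  "strands D z = {(i, t). i < ncomp D \<and> 0 \<le> t \<and> t < 1 \<and> curve D i t = z}"

definition crossings :: "link_diagram \<Rightarrow> complex set" where
  "crossings D = {z. \<exists>p q. p \<in> strands D z \<and> q \<in> strands D z \<and> p \<noteq> q}"

definition under :: "link_diagram \<Rightarrow> complex \<Rightarrow> nat \<times> real" where
  "under D z = (THE p. p \<in> strands D z \<and> p \<noteq> over D z)"

definition velocity :: "link_diagram \<Rightarrow> nat \<times> real \<Rightarrow> complex" where
  "velocity D p = vector_derivative (curve D (fst p)) (at (snd p))"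

text \<open>
  The determinant of the pair \<open>(a, b)\<close>: it is positive iff \<open>b\<close> is reached from \<open>a\<close> by a
  counterclockwise rotation through an angle strictly between 0 and \<open>pi\<close>.
\<close>

definition cross2 :: "complex \<Rightarrow> complex \<Rightarrow> real" where
  "cross2 a b = Im (cnj a * b)"

definition classical_link_diagram :: "link_diagram \<Rightarrow> bool" where
  "classical_link_diagram D \<longleftrightarrow>
     (\<forall>i < ncomp D. curve D i C1_differentiable_on UNIV \<and>
        (\<forall>t. curve D i (t + 1) = curve D i t) \<and>
        (\<forall>t. vector_derivative (curve D i) (at t) \<noteq> 0)) \<and>
     finite (crossings D) \<and>
     (\<forall>z \<in> crossings D. card (strands D z) = 2 \<and> over D z \<in> strands D z \<and>
        (\<forall>p \<in> strands D z. \<forall>q \<in> strands D z. p \<noteq> q \<longrightarrow>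
           cross2 (velocity D p) (velocity D q) \<noteq> 0))"

definition classical_knot_diagram :: "link_diagram \<Rightarrow> bool" where
  "classical_knot_diagram D \<longleftrightarrow> classical_link_diagram D \<and> ncomp D = 1"


section \<open>Orientations, writhe and linking number\<close>

text \<open>
  The value 1 at \<open>i\<close> means that component \<open>i\<close> is directed by its parametrization, -1 that it is
  directed oppositely.
\<close>

definition orientations :: "link_diagram \<Rightarrow> (nat \<Rightarrow> int) set" where
  "orientations D = {..<ncomp D} \<rightarrow>\<^sub>E {1, -1}"

definition direction :: "link_diagram \<Rightarrow> (nat \<Rightarrow> int) \<Rightarrow> nat \<times> real \<Rightarrow> complex" where
  "direction D \<omega> p = of_int (\<omega> (fst p)) * velocity D p"

text \<open>
  Right-handed convention: a crossing is positive iff the direction of the overcrossing strand is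
  turned counterclockwise, through less than \<open>pi\<close>, to reach the direction of the undercrossing strand.
\<close>

definition crossing_sign :: "link_diagram \<Rightarrow> (nat \<Rightarrow> int) \<Rightarrow> complex \<Rightarrow> int" where
  "crossing_sign D \<omega> z =
     (if cross2 (direction D \<omega> (over D z)) (direction D \<omega> (under D z)) > 0 then 1 else -1)"

definition writhe :: "link_diagram \<Rightarrow> (nat \<Rightarrow> int) \<Rightarrow> int" where
  "writhe D \<omega> = (\<Sum>z \<in> crossings D. crossing_sign D \<omega> z)"

definition linking_number :: "link_diagram \<Rightarrow> (nat \<Rightarrow> int) \<Rightarrow> nat \<Rightarrow> nat \<Rightarrow> rat" where
  "linking_number D \<omega> i j =
     of_int (\<Sum>z \<in> {z \<in> crossings D. {fst (over D z), fst (under D z)} = {i, j}}.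
               crossing_sign D \<omega> z) / 2"


section \<open>States\<close>

text \<open>The arcs of a diagram are cut at both strands of every crossing.\<close>

definition arcs :: "link_diagram \<Rightarrow> complex set set" where
  "arcs D = components ((\<Union>i < ncomp D. range (curve D i)) - crossings D)"

text \<open>
  The arc leaving the point of strand \<open>p\<close> in parameter direction \<open>d\<close> (\<open>d\<close> is 1 or -1).
\<close>

definition end_arc :: "link_diagram \<Rightarrow> nat \<times> real \<Rightarrow> real \<Rightarrow> complex set" where
  "end_arc D p d =
     (THE C. C \<in> arcs D \<and> (\<forall>\<^sub>F e in at_right 0. curve D (fst p) (snd p + d * e) \<in> C))"

datatype smoothing = A_smoothing | B_smoothing

text \<open>
  Four rays leave a crossing: the over-rays with direction \<open>a *\<^sub>R velocity D (over D z)\<close> and the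
  under-rays with direction \<open>b *\<^sub>R velocity D (under D z)\<close>, for \<open>a\<close>, \<open>b\<close> in \<open>{1, -1}\<close>. Every local
  arc of a smoothing turns from one over-ray to an adjacent under-ray; it is recorded as \<open>(a, b)\<close>.
  Rotating the overcrossing line counterclockwise to the undercrossing line sweeps the two sectors
  that lie counterclockwise from an over-ray to the next under-ray, that is, those with positive
  determinant. The A-smoothing merges these two sectors, so its two arcs run along the boundary of the
  two other sectors, those with negative determinant.
\<close>

definition smoothing_arcs :: "link_diagram \<Rightarrow> complex \<Rightarrow> smoothing \<Rightarrow> (real \<times> real) set" where
  "smoothing_arcs D z m =
     {(a, b). a \<in> {1, -1} \<and> b \<in> {1, -1} \<and>
        (let r = cross2 (a *\<^sub>R velocity D (over D z)) (b *\<^sub>R velocity D (under D z))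
         in case m of A_smoothing \<Rightarrow> r < 0 | B_smoothing \<Rightarrow> r > 0)}"

definition states :: "link_diagram \<Rightarrow> (complex \<Rightarrow> smoothing) set" where
  "states D = crossings D \<rightarrow>\<^sub>E UNIV"

definition joined :: "link_diagram \<Rightarrow> (complex \<Rightarrow> smoothing) \<Rightarrow> (complex set \<times> complex set) set" where
  "joined D s = {(end_arc D (over D z) a, end_arc D (under D z) b) | z a b.
     z \<in> crossings D \<and> (a, b) \<in> smoothing_arcs D z (s z)}"

definition same_loop :: "link_diagram \<Rightarrow> (complex \<Rightarrow> smoothing) \<Rightarrow> (complex set \<times> complex set) set" where
  "same_loop D s = (joined D s \<union> (joined D s)\<inverse>)\<^sup>*"

text \<open>A loop of a state is given by the set of arcs of the diagram it is glued from.\<close>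

definition loops :: "link_diagram \<Rightarrow> (complex \<Rightarrow> smoothing) \<Rightarrow> complex set set set" where
  "loops D s = arcs D // same_loop D s"

text \<open>The loop containing the local arc \<open>c\<close> of the smoothing at the crossing \<open>z\<close>.\<close>

definition loop_through ::
    "link_diagram \<Rightarrow> (complex \<Rightarrow> smoothing) \<Rightarrow> complex \<Rightarrow> real \<times> real \<Rightarrow> complex set set" where
  "loop_through D s z c = same_loop D s `` {end_arc D (over D z) (fst c)}"

definition properly_labeled ::
    "link_diagram \<Rightarrow> (complex \<Rightarrow> smoothing) \<Rightarrow> (complex set set \<Rightarrow> nat) \<Rightarrow> bool" where
  "properly_labeled D s l \<longleftrightarrow>
     (\<forall>z \<in> crossings D. \<forall>c \<in> smoothing_arcs D z (s z). \<forall>c' \<in> smoothing_arcs D z (s z).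
        c \<noteq> c' \<longrightarrow> l (loop_through D s z c) \<noteq> l (loop_through D s z c'))"

definition proper_labeled_states ::
    "link_diagram \<Rightarrow> ((complex \<Rightarrow> smoothing) \<times> (complex set set \<Rightarrow> nat)) set" where
  "proper_labeled_states D =
     {(s, l). s \<in> states D \<and> l \<in> loops D s \<rightarrow>\<^sub>E {0, 1} \<and> properly_labeled D s l}"


section \<open>The binary bracket\<close>

text \<open>
  Laurent polynomials over the integers, as finitely supported functions on the integer exponents with
  the convolution product.
\<close>

type_synonym laurent = "int \<Rightarrow>\<^sub>0 int"

definition A_pow :: "int \<Rightarrow> laurent" where
  "A_pow k = Poly_Mapping.single k 1"

definition vertex_weight :: "smoothing \<Rightarrow> laurent" where
  "vertex_weight m = (case m of A_smoothing \<Rightarrow> A_pow 1 | B_smoothing \<Rightarrow> A_pow (-1))"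

definition state_weight :: "link_diagram \<Rightarrow> (complex \<Rightarrow> smoothing) \<Rightarrow> laurent" where
  "state_weight D s = (\<Prod>z \<in> crossings D. vertex_weight (s z))"

definition binary_bracket :: "link_diagram \<Rightarrow> laurent" where
  "binary_bracket D = (\<Sum>(s, l) \<in> proper_labeled_states D. state_weight D s)"

definition Inv :: "link_diagram \<Rightarrow> (nat \<Rightarrow> int) \<Rightarrow> laurent" where
  "Inv D \<omega> = A_pow (- writhe D \<omega>) * binary_bracket D"

end

theory Submission
  imports Defs "HOL-Complex_Analysis.Complex_Analysis"
begin

text \<open>
  Let \<open>W\<close> be the sum of the winding numbers of all components. It jumps by one across every
  strand, so its parity is a checkerboard colouring of the plane. Labelling each arc of an oriented
  diagram by the colour on its left gives a label that changes at every passage through a crossing,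
  and at a crossing the smoothing that joins rays of equal label is the orientation-respecting one,
  whose weight is \<open>A\<close> to the sign of the crossing. Conversely, in a properly labeled state opposite
  rays of a strand at a crossing carry distinct labels; comparing such a labelling with the
  checkerboard one along a component yields a constant, which is an orientation of that component.
\<close>

section \<open>Winding numbers near a curve\<close>

text \<open>No global theory of the faces of the diagram is used: colours are compared only in small
  cones beside a strand and in the four sectors of a crossing. The curves are merely C1, so the
  separation of a cone from the diagram rests on chord estimates in which both endpoints are free.
  Passing straight through a crossing carries the point on the left across the other strand, which
  is why the label alternates; that the alternation closes up after a full period needs no count of
  passages, since the colour is a function on the plane. All components enter
  \<open>total_winding\<close>, because the transverse strand may belong to any of them. The
  delicate link is the one between a crossing and the parameters near it: the left normal at such a
  parameter sees the colour only at very small distance, so each sector is filled by translates of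
  one strand along the other, and the strand is approached inside the sector by a limit.\<close>

text \<open>Mean value inequality on a ball where the derivative stays within \<open>c\<close> of
  \<open>f' t0\<close>. Both endpoints are free, so that later a chord between two parameters,
  neither of them \<open>t0\<close>, can be compared with the fixed tangent at
  \<open>t0\<close>.\<close>

lemma C1_strict_differentiable:
  fixes f :: "real \<Rightarrow> complex"
  assumes d: "\<And>t. (f has_vector_derivative f' t) (at t)" and c: "isCont f' t0" and "c > 0"
  obtains \<eta> where "\<eta> > 0"
    "\<And>s t. \<bar>s - t0\<bar> < \<eta> \<Longrightarrow> \<bar>t - t0\<bar> < \<eta> \<Longrightarrow> norm (f t - f s - (t - s) *\<^sub>R f' t0) \<le> c * \<bar>t - s\<bar>"
proof -
  obtain \<eta> where \<eta>: "\<eta> > 0" "\<And>x. \<bar>x - t0\<bar> < \<eta> \<Longrightarrow> dist (f' x) (f' t0) < c"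
    using c \<open>c > 0\<close> unfolding continuous_at_eps_delta dist_real_def by blast
  define S where "S = ball t0 \<eta>"
  have S: "x \<in> S \<longleftrightarrow> \<bar>x - t0\<bar> < \<eta>" for x
    by (simp add: S_def dist_real_def abs_minus_commute)
  have "norm (f t - f s - (t - s) *\<^sub>R f' t0) \<le> c * \<bar>t - s\<bar>" if "s \<in> S" "t \<in> S" for s t
  proof -
    have "norm (f t - f s - (t - s) *\<^sub>R f' t0) \<le> norm (t - s) * c"
    proof (rule vector_differentiable_bound_linearization[where S=S])
      show "closed_segment s t \<subseteq> S" using that by (simp add: S_def closed_segment_subset)
      show "norm (f' x - f' t0) \<le> c" if "x \<in> S" for x
        using \<eta>(2) that by (simp add: S dist_norm less_imp_le)
    qed (use d \<eta> in \<open>auto simp: S intro: has_vector_derivative_at_within\<close>)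
    then show ?thesis by (simp add: mult.commute)
  qed
  then show thesis using that \<eta>(1) S by blast
qed

text \<open>The path avoids the closed ray from \<open>z\<close> in direction \<open>-d\<close>, so
  \<open>Ln ((x - z) / d)\<close> is, up to the constant \<open>Ln d\<close>, a continuous logarithm
  of \<open>x - z\<close> along it; the winding number is its increment over 2 pi i.\<close>

lemma winding_number_off_ray:
  assumes "path M" "d \<noteq> 0" and off: "\<And>x. x \<in> path_image M \<Longrightarrow> (x - z) / d \<notin> \<real>\<^sub>\<le>\<^sub>0"
  shows "winding_number M z =
    (Ln ((pathfinish M - z) / d) - Ln ((pathstart M - z) / d)) / (2 * of_real pi * \<i>)"
proof -
  define q where "q = (\<lambda>x. Ln ((M x - z) / d) + Ln d)"
  have off': "(M x - z) / d \<notin> \<real>\<^sub>\<le>\<^sub>0" if "x \<in> {0..1}" for x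
    using off that by (auto simp: path_image_def)
  have "path q" unfolding path_def q_def
    using assms(1)[unfolded path_def] off' \<open>d \<noteq> 0\<close> by (intro continuous_intros) auto
  have "winding_number M z = winding_number (\<lambda>x. M x - z) 0"
    by (rule winding_number_offset)
  also have "\<dots> = winding_number (exp \<circ> q) 0"
  proof (rule winding_number_cong)
    fix x :: real assume "0 \<le> x" "x \<le> 1"
    then have "(M x - z) / d \<noteq> 0" using off'[of x] by auto
    then show "M x - z = (exp \<circ> q) x" using \<open>d \<noteq> 0\<close> by (simp add: q_def exp_add)
  qed
  also have "\<dots> = (pathfinish q - pathstart q) / (2 * of_real pi * \<i>)"
    by (rule winding_number_compose_exp) fact
  finally show ?thesis by (simp add: q_def pathfinish_def pathstart_def)
qed

lemma periodic_add_int: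
  fixes g :: "real \<Rightarrow> 'a"
  assumes per: "\<And>t. g (t + 1) = g t"
  shows "g (t + of_int k) = g t"
proof (induction k)
  case (nonneg n) show ?case
  proof (induction n)
    case (Suc n) then show ?case using per[of "t + real n"] by (simp add: ac_simps)
  qed simp
next
  case (neg n) show ?case
  proof (induction n)
    case 0 then show ?case using per[of "t - 1"] by simp
  next
    case (Suc n) then show ?case using per[of "t - real n - 2"] by (simp add: algebra_simps)
  qed
qed

lemma winding_number_shift_periodic:
  fixes g :: "real \<Rightarrow> complex"
  assumes "continuous_on UNIV g" and per: "\<And>t. g (t + 1) = g t" and "z \<notin> range g"
  shows "winding_number (\<lambda>x. g (a + x)) z = winding_number g z"
proof -
  note perz = periodic_add_int[of g, OF per]
  have "shiftpath (frac a) g = (\<lambda>x. g (a + x))"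
  proof
    fix x
    have "g (frac a + x) = g (a + x)" using perz[of "a + x" "- \<lfloor>a\<rfloor>"] by (simp add: frac_def algebra_simps)
    then show "shiftpath (frac a) g x = g (a + x)"
      using per[of "frac a + x - 1"] by (auto simp: shiftpath_def)
  qed
  moreover have "winding_number (shiftpath (frac a) g) z = winding_number g z"
  proof (rule winding_number_shiftpath)
    show "path g" using assms(1) by (auto simp: path_def intro: continuous_on_subset)
    show "z \<notin> path_image g" using assms(3) by (auto simp: path_image_def)
    show "pathfinish g = pathstart g" using per[of 0] by (simp add: pathfinish_def pathstart_def)
    show "frac a \<in> {0..1}" using frac_lt_1[of a] by (auto simp: less_imp_le)
  qed
  ultimately show ?thesis by simp
qed

text \<open>The loop is cut into a short piece \<open>M\<close> around \<open>t0\<close> and two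
  pieces that miss the point \<open>g t0\<close>. The latter have winding numbers continuous at that
  point, so their contributions to the difference vanish in the limit; the contribution of
  \<open>M\<close> is computed by explicit logarithms and tends to 1.\<close>

lemma winding_number_jump:
  fixes g :: "real \<Rightarrow> complex"
  assumes cont: "continuous_on UNIV g" and per: "\<And>t. g (t + 1) = g t"
    and der: "(g has_vector_derivative v) (at t0)" and inj: "\<And>t. g t = g t0 \<Longrightarrow> t - t0 \<in> \<int>"
    and n: "cross2 v n > 0"
    and offp: "\<forall>\<^sub>F s in at_right 0. g t0 + s *\<^sub>R n \<notin> range g"
    and offm: "\<forall>\<^sub>F s in at_right 0. g t0 - s *\<^sub>R n \<notin> range g"
  shows "\<forall>\<^sub>F s in at_right 0. winding_number g (g t0 + s *\<^sub>R n) = winding_number g (g t0 - s *\<^sub>R n) + 1"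
proof -
  have "n \<noteq> 0" using n by (auto simp: cross2_def)
  define p where "p = g t0"
  \<comment> \<open>The signed coordinate of the curve transverse to the line through
    \<open>p\<close> along \<open>n\<close>. It decreases through 0 at \<open>t0\<close>, so near
    \<open>t0\<close> the curve meets that line only in \<open>p\<close>.\<close>
  define \<phi> where "\<phi> = (\<lambda>t. Im ((g t - p) / n))"
  have "Im (v / n) < 0"
  proof -
    have "(Re n)\<^sup>2 + (Im n)\<^sup>2 > 0" using \<open>n \<noteq> 0\<close> by (simp add: complex_neq_0)
    moreover have "Im v * Re n - Re v * Im n < 0" using n by (simp add: cross2_def algebra_simps)
    ultimately show ?thesis by (simp add: Im_divide divide_neg_pos)
  qed
  moreover have "DERIV \<phi> t0 :> Im (v / n)"
  proof -
    have "((\<lambda>t. (g t - p) / n) has_vector_derivative v / n) (at t0)"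
      by (auto intro!: derivative_eq_intros der)
    then have "((\<lambda>t. Im ((g t - p) / n)) has_vector_derivative Im (v / n)) (at t0)"
      by (rule bounded_linear.has_vector_derivative[OF bounded_linear_Im])
    then show ?thesis by (simp add: \<phi>_def has_real_derivative_iff_has_vector_derivative)
  qed
  ultimately obtain d1 d2 where d: "d1 > 0" "d2 > 0"
    "\<And>h. h > 0 \<Longrightarrow> h < d1 \<Longrightarrow> \<phi> (t0 - h) > \<phi> t0" "\<And>h. h > 0 \<Longrightarrow> h < d2 \<Longrightarrow> \<phi> (t0 + h) < \<phi> t0"
    using DERIV_neg_dec_left[of \<phi> "Im (v / n)" t0] DERIV_neg_dec_right[of \<phi> "Im (v / n)" t0] by blast
  have "\<phi> t0 = 0" by (simp add: \<phi>_def p_def)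
  \<comment> \<open>The bound 1/2 keeps the cut points \<open>1/2 - \<delta>\<close> and
    \<open>1/2 + \<delta>\<close> inside the unit interval; the halving makes all bounds
    strict.\<close>
  define \<delta> where "\<delta> = min (min d1 d2) (1/2) / 2"
  have \<delta>: "\<delta> > 0" "\<delta> < d1" "\<delta> < d2" "\<delta> < 1/2" using d by (auto simp: \<delta>_def)
  \<comment> \<open>Starting half a period before \<open>t0\<close> puts the passage through
    \<open>p\<close> at the middle parameter 1/2.\<close>
  define h where "h = (\<lambda>x. g (t0 - 1/2 + x))"
  have "path h" unfolding path_def h_def
    by (intro continuous_intros continuous_on_compose2[OF cont]) auto
  define A where "A = subpath 0 (1/2 - \<delta>) h"
  define M where "M = subpath (1/2 - \<delta>) (1/2 + \<delta>) h"
  define B where "B = subpath (1/2 + \<delta>) 1 h"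
  have pathA: "path A" and pathM: "path M" and pathB: "path B"
    unfolding A_def M_def B_def using \<open>path h\<close> \<delta> by (auto intro!: path_subpath)
  have imh: "path_image h \<subseteq> range g" by (auto simp: path_image_def h_def)
  have split: "winding_number g z = winding_number A z + winding_number M z + winding_number B z"
    if "z \<notin> range g" for z
  proof -
    have z: "z \<notin> path_image h" using that imh by auto
    have "winding_number g z = winding_number h z"
      unfolding h_def using winding_number_shift_periodic[OF cont per that] by simp
    also have "\<dots> = winding_number (subpath 0 1 h) z" by simp
    also have "\<dots> = winding_number (subpath 0 (1/2+\<delta>) h) z + winding_number B z"
      unfolding B_def using winding_number_subpath_combine[OF \<open>path h\<close> z] \<delta> by simp
    also have "winding_number (subpath 0 (1/2+\<delta>) h) z = winding_number A z + winding_number M z"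
      unfolding A_def M_def using winding_number_subpath_combine[OF \<open>path h\<close> z] \<delta> by simp
    finally show ?thesis .
  qed
  have far: "h x \<noteq> p" if "x \<in> {0..1/2 - \<delta>} \<union> {1/2 + \<delta>..1}" for x
  proof
    assume "h x = p"
    then have "x - 1/2 \<in> \<int>" using inj[of "t0 - 1/2 + x"] by (simp add: h_def p_def)
    moreover have "\<bar>x - 1/2\<bar> < 1" using that \<delta> by auto
    ultimately have "x - 1/2 = 0" by (meson Ints_nonzero_abs_less1)
    then show False using that \<delta> by auto
  qed
  have "p \<notin> path_image A"
    unfolding A_def using far \<delta>
    by (subst path_image_subpath_gen) (fastforce simp: closed_segment_eq_real_ivl)
  have "p \<notin> path_image B"
    unfolding B_def using far \<delta>
    by (subst path_image_subpath_gen) (fastforce simp: closed_segment_eq_real_ivl)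
  define a1 where "a1 = (g (t0 - \<delta>) - p) / n"
  define a2 where "a2 = (g (t0 + \<delta>) - p) / n"
  have a1: "Im a1 > 0" using d(3)[of \<delta>] \<delta> \<open>\<phi> t0 = 0\<close> by (simp add: a1_def \<phi>_def)
  have a2: "Im a2 < 0" using d(4)[of \<delta>] \<delta> \<open>\<phi> t0 = 0\<close> by (simp add: a2_def \<phi>_def)
  have near: "x = p \<or> Im ((x - p) / n) \<noteq> 0" if xM: "x \<in> path_image M" for x
  proof -
    have "path_image M = h ` {1/2 - \<delta>..1/2 + \<delta>}"
      unfolding M_def using \<delta> by (simp add: path_image_subpath)
    then obtain y where "x = h y" "y \<in> {1/2 - \<delta>..1/2 + \<delta>}" using xM by auto
    then have y: "x = h y" "\<bar>y - 1/2\<bar> \<le> \<delta>" by auto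
    consider "y = 1/2" | "y > 1/2" | "y < 1/2" by linarith
    then show ?thesis
    proof cases
      case 1
      have "x = p" unfolding y(1) h_def p_def 1 by simp
      then show ?thesis ..
    next
      case 2
      then have "\<phi> (t0 + (y - 1/2)) < 0" using d(4)[of "y - 1/2"] y \<delta> \<open>\<phi> t0 = 0\<close> by auto
      then show ?thesis by (auto simp: \<phi>_def y h_def algebra_simps)
    next
      case 3
      then have "\<phi> (t0 - (1/2 - y)) > 0" using d(3)[of "1/2 - y"] y \<delta> \<open>\<phi> t0 = 0\<close> by auto
      then show ?thesis by (auto simp: \<phi>_def y h_def algebra_simps)
    qed
  qed
  have ends: "pathfinish M = p + n * a2" "pathstart M = p + n * a1"
    using \<open>n \<noteq> 0\<close> by (simp_all add: M_def h_def a1_def a2_def)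
  \<comment> \<open>From the shifted point the ray continuing in direction \<open>n\<close> misses
    \<open>M\<close>, because the only point of \<open>M\<close> on that line is \<open>p\<close>,
    which lies behind. For the point on the other side the opposite ray serves.\<close>
  have Mp: "winding_number M (p + s *\<^sub>R n) = (Ln (s - a2) - Ln (s - a1)) / (2 * of_real pi * \<i>)"
    if "s > 0" for s
  proof -
    have "(x - (p + s *\<^sub>R n)) / (- n) \<notin> \<real>\<^sub>\<le>\<^sub>0" if "x \<in> path_image M" for x
    proof -
      have eq: "(x - (p + s *\<^sub>R n)) / (- n) = s - (x - p) / n"
        using \<open>n \<noteq> 0\<close> by (simp add: field_simps scaleR_conv_of_real)
      show ?thesis unfolding eq complex_nonpos_Reals_iff using near[OF that] \<open>s > 0\<close> by auto
    qed
    then have "winding_number M (p + s *\<^sub>R n) =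
      (Ln ((p + n * a2 - (p + s *\<^sub>R n)) / (-n)) - Ln ((p + n * a1 - (p + s *\<^sub>R n)) / (-n))) / (2 * of_real pi * \<i>)"
      using winding_number_off_ray[OF pathM, of "-n"] \<open>n \<noteq> 0\<close> ends by simp
    moreover have "(p + n * a - (p + s *\<^sub>R n)) / (-n) = s - a" for a :: complex
      using \<open>n \<noteq> 0\<close> by (simp add: field_simps scaleR_conv_of_real)
    ultimately show ?thesis by (simp only:)
  qed
  have Mm: "winding_number M (p - s *\<^sub>R n) = (Ln (s + a2) - Ln (s + a1)) / (2 * of_real pi * \<i>)"
    if "s > 0" for s
  proof -
    have "(x - (p - s *\<^sub>R n)) / n \<notin> \<real>\<^sub>\<le>\<^sub>0" if "x \<in> path_image M" for x
    proof -
      have eq: "(x - (p - s *\<^sub>R n)) / n = s + (x - p) / n"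
        using \<open>n \<noteq> 0\<close> by (simp add: field_simps scaleR_conv_of_real)
      show ?thesis unfolding eq complex_nonpos_Reals_iff using near[OF that] \<open>s > 0\<close> by auto
    qed
    then have "winding_number M (p - s *\<^sub>R n) =
      (Ln ((p + n * a2 - (p - s *\<^sub>R n)) / n) - Ln ((p + n * a1 - (p - s *\<^sub>R n)) / n)) / (2 * of_real pi * \<i>)"
      using winding_number_off_ray[OF pathM, of "n"] \<open>n \<noteq> 0\<close> ends by simp
    moreover have "(p + n * a - (p - s *\<^sub>R n)) / n = s + a" for a :: complex
      using \<open>n \<noteq> 0\<close> by (simp add: field_simps scaleR_conv_of_real)
    ultimately show ?thesis by (simp only:)
  qed
  define E where "E = (\<lambda>s. winding_number g (p + s *\<^sub>R n) - winding_number g (p - s *\<^sub>R n))"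
  have tz: "((\<lambda>s::real. p + s *\<^sub>R n) \<longlongrightarrow> p) (at_right 0)" "((\<lambda>s::real. p - s *\<^sub>R n) \<longlongrightarrow> p) (at_right 0)"
    by (auto intro!: tendsto_eq_intros)
  have tA: "((\<lambda>s. winding_number P (p + s *\<^sub>R n) - winding_number P (p - s *\<^sub>R n)) \<longlongrightarrow> 0) (at_right 0)"
    if "path P" "p \<notin> path_image P" for P
  proof -
    have "isCont (winding_number P) p" using continuous_at_winding_number that by blast
    then have "((\<lambda>s. winding_number P (p + s *\<^sub>R n) - winding_number P (p - s *\<^sub>R n)) \<longlongrightarrow>
       winding_number P p - winding_number P p) (at_right 0)"
      by (intro tendsto_diff isCont_tendsto_compose[of _ "winding_number P"] tz)
    then show ?thesis by simp
  qed
  have nonpos: "z \<notin> \<real>\<^sub>\<le>\<^sub>0" if "Im z \<noteq> 0" for z using that by (auto simp: complex_nonpos_Reals_iff)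
  have tM: "((\<lambda>s. (Ln (of_real s - a2) - Ln (s - a1)) / (2 * of_real pi * \<i>) - (Ln (s + a2) - Ln (s + a1)) / (2 * of_real pi * \<i>)) \<longlongrightarrow>
     (Ln (of_real 0 - a2) - Ln (of_real 0 - a1)) / (2 * of_real pi * \<i>) - (Ln (of_real 0 + a2) - Ln (of_real 0 + a1)) / (2 * of_real pi * \<i>)) (at_right 0)"
    using a1 a2 by (intro tendsto_intros nonpos) auto
  \<comment> \<open>\<open>a1\<close> lies in the upper and \<open>a2\<close> in the lower
    half-plane, so negation shifts their logarithms by -pi i and +pi i. The difference of the shifts
    is 2 pi i, the source of the jump by 1.\<close>
  have "a1 \<noteq> 0" "a2 \<noteq> 0" using a1 a2 by auto
  then have "Ln (- a2) = Ln a2 + \<i> * pi" "Ln (- a1) = Ln a1 - \<i> * pi"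
    using a1 a2 by (auto simp: Ln_minus)
  then have lim: "(Ln (of_real 0 - a2) - Ln (of_real 0 - a1)) / (2 * of_real pi * \<i>) - (Ln (of_real 0 + a2) - Ln (of_real 0 + a1)) / (2 * of_real pi * \<i>) = 1"
    by (simp flip: diff_divide_distrib)
  have ev: "\<forall>\<^sub>F s in at_right 0. p + s *\<^sub>R n \<notin> range g \<and> p - s *\<^sub>R n \<notin> range g \<and> s > 0"
    using offp offm eventually_at_right_less[of 0] unfolding p_def by eventually_elim auto
  have "(E \<longlongrightarrow> 0 + 1 + 0) (at_right 0)"
  proof (rule Lim_transform_eventually)
    show "((\<lambda>s. (winding_number A (p + s *\<^sub>R n) - winding_number A (p - s *\<^sub>R n)) +
       ((Ln (of_real s - a2) - Ln (s - a1)) / (2 * of_real pi * \<i>) - (Ln (s + a2) - Ln (s + a1)) / (2 * of_real pi * \<i>)) +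
       (winding_number B (p + s *\<^sub>R n) - winding_number B (p - s *\<^sub>R n))) \<longlongrightarrow> 0 + 1 + 0) (at_right 0)"
      using tM unfolding lim
      by (intro tendsto_add tA pathA pathB \<open>p \<notin> path_image A\<close> \<open>p \<notin> path_image B\<close>)
  next
    show "\<forall>\<^sub>F s in at_right 0. (winding_number A (p + s *\<^sub>R n) - winding_number A (p - s *\<^sub>R n)) +
       ((Ln (of_real s - a2) - Ln (s - a1)) / (2 * of_real pi * \<i>) - (Ln (s + a2) - Ln (s + a1)) / (2 * of_real pi * \<i>)) +
       (winding_number B (p + s *\<^sub>R n) - winding_number B (p - s *\<^sub>R n)) = E s"
      using ev by eventually_elim (simp add: E_def split Mp Mm)
  qed
  \<comment> \<open>Off the curve \<open>E\<close> takes integer values, so closeness to 1 becomes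
    equality.\<close>
  then have "\<forall>\<^sub>F s in at_right 0. dist (E s) 1 < 1"
    by (intro tendstoD) auto
  then show ?thesis using ev
  proof eventually_elim
    case (elim s)
    have int: "winding_number g z \<in> \<int>" if "z \<notin> range g" for z
    proof (rule integer_winding_number)
      show "path g" using cont by (auto simp: path_def intro: continuous_on_subset)
      show "z \<notin> path_image g" using that by (auto simp: path_image_def)
      show "pathfinish g = pathstart g" using per[of 0] by (simp add: pathfinish_def pathstart_def)
    qed
    have "E s - 1 \<in> \<int>" unfolding E_def using elim int by auto
    then obtain k where k: "E s - 1 = of_int k" by (rule Ints_cases)
    have "\<bar>real_of_int k\<bar> < 1" using elim(1) by (simp add: dist_norm k)
    then have "k = 0" by simp
    then have "E s = 1" using k by simp
    then show ?case by (simp add: E_def p_def algebra_simps)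
  qed
qed

section \<open>The planar determinant\<close>

lemma cross2_eq: "cross2 a b = Re a * Im b - Im a * Re b"
  by (simp add: cross2_def)

lemma cross2_algebra:
  "cross2 a (b + c) = cross2 a b + cross2 a c" "cross2 a (b - c) = cross2 a b - cross2 a c"
  "cross2 (a + b) c = cross2 a c + cross2 b c" "cross2 (a - b) c = cross2 a c - cross2 b c"
  "cross2 (x *\<^sub>R a) b = x * cross2 a b" "cross2 a (x *\<^sub>R b) = x * cross2 a b"
  "cross2 a 0 = 0" "cross2 0 a = 0" "cross2 a a = 0"
  by (simp_all add: cross2_eq algebra_simps)

lemma cross2_swap: "cross2 a b = - cross2 b a"
  by (simp add: cross2_eq)

lemma cross2_le_norm: "\<bar>cross2 a b\<bar> \<le> norm a * norm b"
proof -
  have "\<bar>cross2 a b\<bar> \<le> norm (cnj a * b)" unfolding cross2_def by (rule abs_Im_le_cmod)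
  then show ?thesis by (simp add: norm_mult)
qed

text \<open>Multiplication by the imaginary unit is the left quarter turn. In particular a vector
  has positive determinant with its own left normal.\<close>

lemma cross2_rotated: "cross2 a (\<i> * b) = a \<bullet> b"
  by (simp add: cross2_eq inner_complex_def)

lemma cross2_tendsto [tendsto_intros]:
  "(f \<longlongrightarrow> a) F \<Longrightarrow> (g \<longlongrightarrow> b) F \<Longrightarrow> ((\<lambda>x. cross2 (f x) (g x)) \<longlongrightarrow> cross2 a b) F"
  unfolding cross2_def by (intro tendsto_intros)

text \<open>Cramer's rule: the determinant with \<open>v\<close> or with \<open>v'\<close> isolates
  one coefficient of the combination. For a nonzero determinant this is a quantitative linear
  independence of the two tangents at a crossing.\<close>

lemma norm_transversal_combination:
  "\<bar>cross2 v v'\<bar> * (\<bar>p\<bar> + \<bar>\<tau>\<bar>) \<le> (norm v + norm v') * norm (p *\<^sub>R v' - \<tau> *\<^sub>R v)"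
proof -
  let ?u = "p *\<^sub>R v' - \<tau> *\<^sub>R v"
  have "\<bar>p\<bar> * \<bar>cross2 v v'\<bar> = \<bar>cross2 v ?u\<bar>" by (simp add: cross2_algebra abs_mult)
  moreover have "\<bar>\<tau>\<bar> * \<bar>cross2 v v'\<bar> = \<bar>cross2 v' ?u\<bar>"
    by (simp add: cross2_algebra abs_mult cross2_swap[of v' v])
  ultimately show ?thesis
    using cross2_le_norm[of v ?u] cross2_le_norm[of v' ?u] by (simp add: algebra_simps)
qed

section \<open>Integer translates and locally constant predicates\<close>

lemma frac_eqE:
  fixes s t :: real
  assumes "frac t = frac s" obtains k :: int where "t = s + of_int k"
proof
  show "t = s + of_int (\<lfloor>t\<rfloor> - \<lfloor>s\<rfloor>)" using assms by (simp add: frac_def)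
qed

text \<open>Evaluates predicates that are themselves defined by an eventuality, such as
  \<open>left_even\<close>: a nontrivial filter cannot support both truth values.\<close>

lemma eventually_eq_const:
  assumes "\<forall>\<^sub>F x in F. P x = b" "F \<noteq> bot" shows "eventually P F = b"
proof (cases b)
  case False
  then have "\<not> eventually P F"
    using assms eventually_elim2[of "\<lambda>x. P x = b" F P "\<lambda>_. False"] by auto
  then show ?thesis using False by simp
qed (use assms in simp)

text \<open>The hypothesis concerns punctured neighbourhoods, so \<open>P\<close> may be arbitrary
  at isolated points. Replacing \<open>P\<close> by its limit value \<open>Q\<close> repairs these
  points; \<open>Q\<close> is locally constant, hence constant on the connected line. The
  exceptional points will be the parameters of crossings.\<close>

lemma locally_constant_except_points:
  fixes P :: "real \<Rightarrow> bool"
  assumes "\<And>t. \<exists>b. \<forall>\<^sub>F x in at t. P x = b"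
  shows "\<exists>b. \<forall>t. \<forall>\<^sub>F x in at t. P x = b"
proof -
  define Q where "Q t \<longleftrightarrow> (\<forall>\<^sub>F x in at t. P x)" for t
  have Q: "\<forall>\<^sub>F x in at t. P x = Q t" for t
  proof -
    obtain b where b: "\<forall>\<^sub>F x in at t. P x = b" using assms by blast
    then have "Q t = b" unfolding Q_def by (intro eventually_eq_const) auto
    then show ?thesis using b by simp
  qed
  have "\<forall>\<^sub>F y in at t. Q t = Q y" for t
  proof -
    obtain S where S: "open S" "t \<in> S" "\<And>x. x \<in> S \<Longrightarrow> x \<noteq> t \<Longrightarrow> P x = Q t"
      using Q[of t] unfolding eventually_at_topological by blast
    have "\<forall>\<^sub>F x in at y. P x = Q t" if "y \<in> S" "y \<noteq> t" for y
    proof -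
      have "\<forall>\<^sub>F x in at y. x \<in> S - {t}"
        using S(1) that by (intro eventually_at_in_open') auto
      then show ?thesis by (rule eventually_mono) (use S(3) in blast)
    qed
    then have "\<forall>\<^sub>F y in at t. \<forall>\<^sub>F x in at y. P x = Q t"
      unfolding eventually_at_topological[of _ t] using S(1,2) by (intro exI[of _ S]) simp
    then show ?thesis
    proof eventually_elim
      case (elim y)
      have "eventually P (at y) = Q t" by (rule eventually_eq_const[OF elim]) simp
      then show ?case by (simp only: Q_def[of y])
    qed
  qed
  then have Q0: "Q t = Q 0" for t
    by (intro connected_local_const[of UNIV t 0 Q]) auto
  show ?thesis
    by (intro exI[of _ "Q 0"] allI, subst Q0[symmetric], rule Q)
qed

lemma eventually_at_from_rays:
  fixes t :: real
  assumes "\<And>d. d \<in> {1, -1} \<Longrightarrow> \<forall>\<^sub>F e in at_right 0. P (t + d * e)"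
  shows "\<forall>\<^sub>F x in at t. P x"
proof -
  obtain r where r: "r > 0" "\<And>e. 0 < e \<Longrightarrow> e < r \<Longrightarrow> P (t + e)"
    using assms[of 1] unfolding eventually_at_right_field by auto
  obtain l where l: "l > 0" "\<And>e. 0 < e \<Longrightarrow> e < l \<Longrightarrow> P (t - e)"
    using assms[of "-1"] unfolding eventually_at_right_field by auto
  have "P x" if "x \<noteq> t" "dist x t < min l r" for x
    using that r(2)[of "x - t"] l(2)[of "t - x"] by (cases "x < t") (auto simp: dist_real_def)
  then show ?thesis unfolding eventually_at using l(1) r(1) by (intro exI[of _ "min l r"]) auto
qed

section \<open>The checkerboard colouring\<close>

locale link =
  fixes D assumes diagram: "classical_link_diagram D"
begin

definition "vel i t = vector_derivative (curve D i) (at t)"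
definition "shadow = (\<Union>i<ncomp D. range (curve D i))"
definition "total_winding z = (\<Sum>i<ncomp D. winding_number (curve D i) z)"
text \<open>\<open>winding_number\<close> is complex valued, so parity is expressed through an
  integer witness; off the shadow the total is an integer by
  \<open>total_winding_Ints\<close>.\<close>

definition "even_winding z \<longleftrightarrow> (\<exists>m::int. total_winding z = of_int (2 * m))"

text \<open>\<open>\<i> * vel i t\<close> is the left normal of the parametrized curve, so this is a
  one-sided limit of the colour. Off the crossings the colour is constant on a whole left cone
  (\<open>left_cone\<close>), and there the negation of \<open>left_even\<close> means that the left
  side has the other colour.\<close>

definition "left_even i t \<longleftrightarrow>
  (\<forall>\<^sub>F s in at_right 0. even_winding (curve D i t + s *\<^sub>R (\<i> * vel i t)))"

lemma finite_crossings: "finite (crossings D)"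
  using diagram by (simp add: classical_link_diagram_def)

lemma curve_deriv: "i < ncomp D \<Longrightarrow> (curve D i has_vector_derivative vel i t) (at t)"
  using diagram unfolding classical_link_diagram_def C1_differentiable_on_eq vel_def
  by (auto simp flip: vector_derivative_works)

lemma isCont_vel: "i < ncomp D \<Longrightarrow> isCont (vel i) t"
  using diagram unfolding classical_link_diagram_def C1_differentiable_on_eq vel_def
  by (auto simp: continuous_on_eq_continuous_at)

lemma vel_nonzero: "i < ncomp D \<Longrightarrow> vel i t \<noteq> 0"
  using diagram unfolding classical_link_diagram_def vel_def by auto

lemma continuous_on_curve: "i < ncomp D \<Longrightarrow> continuous_on S (curve D i)"
  using curve_deriv by (meson continuous_at_imp_continuous_on has_vector_derivative_continuous)

lemma isCont_curve: "i < ncomp D \<Longrightarrow> isCont (curve D i) t"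
  using curve_deriv has_vector_derivative_continuous by blast

lemma curve_add_1: "i < ncomp D \<Longrightarrow> curve D i (t + 1) = curve D i t"
  using diagram unfolding classical_link_diagram_def by auto

lemma curve_add_int: "i < ncomp D \<Longrightarrow> curve D i (t + of_int k) = curve D i t"
  by (rule periodic_add_int) (rule curve_add_1)

lemma vel_add_int: assumes "i < ncomp D" shows "vel i (t + of_int k) = vel i t"
proof -
  have "(curve D i \<circ> (\<lambda>x. x + of_int k) has_vector_derivative 1 *\<^sub>R vel i (t + of_int k)) (at t)"
    by (rule vector_diff_chain_at) (auto intro!: derivative_eq_intros curve_deriv assms)
  then have "(curve D i has_vector_derivative vel i (t + of_int k)) (at t)"
    by (simp add: curve_add_int assms o_def)
  then show ?thesis using curve_deriv[OF assms] vector_derivative_unique_at by blast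
qed

lemma left_even_add_int: "i < ncomp D \<Longrightarrow> left_even i (t + of_int k) = left_even i t"
  by (simp add: left_even_def curve_add_int vel_add_int)

lemma curve_frac: "i < ncomp D \<Longrightarrow> curve D i (frac t) = curve D i t"
  using curve_add_int[of i t "- \<lfloor>t\<rfloor>"] by (simp add: frac_def)

lemma vel_frac: "i < ncomp D \<Longrightarrow> vel i (frac t) = vel i t"
  using vel_add_int[of i t "- \<lfloor>t\<rfloor>"] by (simp add: frac_def)

lemma strand_frac: "i < ncomp D \<Longrightarrow> curve D i t = z \<Longrightarrow> (i, frac t) \<in> strands D z"
  by (simp add: strands_def curve_frac frac_lt_1)

text \<open>Strands live in the half-open unit interval, whereas the analysis uses all real
  parameters; equality of \<open>frac\<close> expresses that two real parameters name the same
  strand.\<close>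

lemma same_strand:
  assumes "i < ncomp D" "j < ncomp D" "curve D i t = curve D j s" "curve D i t \<notin> crossings D"
  shows "i = j \<and> frac t = frac s"
  using assms strand_frac[of i t] strand_frac[of j s] by (auto simp: crossings_def)

lemma crossing_strands:
  assumes "i < ncomp D" "j < ncomp D" "k < ncomp D"
    and "curve D i t = z" "curve D j s = z" "curve D k u = z" "\<not> (i = j \<and> frac t = frac s)"
  shows "k = i \<and> frac u = frac t \<or> k = j \<and> frac u = frac s"
proof -
  have S: "(i, frac t) \<in> strands D z" "(j, frac s) \<in> strands D z" "(k, frac u) \<in> strands D z"
    using assms strand_frac by auto
  then have "z \<in> crossings D" using assms(7) unfolding crossings_def by blast
  then have "card (strands D z) = 2" using diagram by (simp add: classical_link_diagram_def)
  then obtain p q where "strands D z = {p, q}" by (meson card_2_iff)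
  then show ?thesis using S assms(7) by auto
qed

lemma crossing_transversal:
  assumes "i < ncomp D" "j < ncomp D"
    and "curve D i t = z" "curve D j s = z" "\<not> (i = j \<and> frac t = frac s)"
  shows "cross2 (vel i t) (vel j s) \<noteq> 0"
proof -
  have S: "(i, frac t) \<in> strands D z" "(j, frac s) \<in> strands D z"
    using assms strand_frac by auto
  then have "z \<in> crossings D" using assms(5) unfolding crossings_def by blast
  then have "cross2 (velocity D (i, frac t)) (velocity D (j, frac s)) \<noteq> 0"
    using diagram S assms(5) unfolding classical_link_diagram_def by blast
  then show ?thesis using vel_frac assms(1,2) by (simp add: velocity_def flip: vel_def)
qed

section \<open>The diagram in a small neighbourhood of a point\<close>

text \<open>Compactness turns closeness in the plane into closeness of parameters: parameters
  bounded away from all preimages of \<open>z\<close> have an image at positive distance from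
  \<open>z\<close>. This excludes that a remote piece of the diagram intrudes near
  \<open>z\<close>.\<close>

lemma near_point_preimage:
  assumes "\<eta> > 0"
  obtains r where "r > 0"
    "\<And>j t. j < ncomp D \<Longrightarrow> dist (curve D j t) z < r \<Longrightarrow> \<exists>t'. curve D j t' = z \<and> \<bar>t - t'\<bar> < \<eta>"
proof -
  have one: "\<exists>r>0. \<forall>t. dist (curve D j t) z < r \<longrightarrow> (\<exists>t'. curve D j t' = z \<and> \<bar>t - t'\<bar> < \<eta>)"
    if j: "j < ncomp D" for j
  proof -
    define K where "K = {0..1} \<inter> (\<Inter>t'\<in>{t'. curve D j t' = z}. - ball t' \<eta>)"
    have "compact K" unfolding K_def by (intro compact_Int_closed closed_INT) auto
    then have "compact (curve D j ` K)"
      by (intro compact_continuous_image continuous_on_curve j)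
    moreover have "z \<notin> curve D j ` K"
    proof
      assume "z \<in> curve D j ` K"
      then obtain x where "z = curve D j x" "x \<in> K" by auto
      then have "x \<notin> ball x \<eta>" unfolding K_def by fast
      then show False using assms by simp
    qed
    ultimately obtain r where r: "r > 0" "\<And>x. x \<in> curve D j ` K \<Longrightarrow> r \<le> dist z x"
      using separate_point_closed[of "curve D j ` K" z] compact_imp_closed by blast
    have "\<exists>t'. curve D j t' = z \<and> \<bar>t - t'\<bar> < \<eta>" if t: "dist (curve D j t) z < r" for t
    proof -
      have "frac t \<notin> K"
      proof
        assume "frac t \<in> K"
        then have "r \<le> dist z (curve D j (frac t))" by (intro r(2) imageI)
        then show False using t curve_frac[OF j, of t] by (simp add: dist_commute)
      qed
      then obtain t' where t': "curve D j t' = z" "\<bar>frac t - t'\<bar> < \<eta>"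
        using frac_lt_1[of t] by (auto simp: K_def dist_real_def less_imp_le abs_minus_commute)
      then show ?thesis using curve_add_int[OF j, of t' "\<lfloor>t\<rfloor>"]
        by (intro exI[of _ "t' + of_int \<lfloor>t\<rfloor>"]) (auto simp: frac_def algebra_simps)
    qed
    then show ?thesis using r(1) by blast
  qed
  then obtain r where r: "\<And>j. j < ncomp D \<Longrightarrow> r j > 0"
    "\<And>j t. j < ncomp D \<Longrightarrow> dist (curve D j t) z < r j \<Longrightarrow> \<exists>t'. curve D j t' = z \<and> \<bar>t - t'\<bar> < \<eta>"
    by metis
  \<comment> \<open>The element 1 keeps the set nonempty when there are no components.\<close>
  define R where "R = Min (insert 1 (r ` {..<ncomp D}))"
  show thesis
  proof (rule that)
    show "R > 0" unfolding R_def using r(1) by (subst Min_gr_iff) auto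
    fix j t assume j: "j < ncomp D" and "dist (curve D j t) z < R"
    moreover have "R \<le> r j" unfolding R_def using j by (intro Min_le) auto
    ultimately show "\<exists>t'. curve D j t' = z \<and> \<bar>t - t'\<bar> < \<eta>" using r(2)[OF j] by simp
  qed
qed

lemma strict_differentiable:
  assumes "i < ncomp D" "c > 0"
  obtains \<eta> where "\<eta> > 0" "\<And>s t. \<bar>s - t0\<bar> < \<eta> \<Longrightarrow> \<bar>t - t0\<bar> < \<eta> \<Longrightarrow>
    norm (curve D i t - curve D i s - (t - s) *\<^sub>R vel i t0) \<le> c * \<bar>t - s\<bar>"
  using C1_strict_differentiable[of "curve D i" "vel i" t0 c] curve_deriv isCont_vel assms by metis

text \<open>A nonzero velocity keeps the curve from returning at once to its own point, so each
  single crossing is avoided on a punctured neighbourhood; finiteness of the crossings does the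
  rest.\<close>

lemma eventually_noncrossing:
  assumes "i < ncomp D"
  shows "\<forall>\<^sub>F t in at t0. curve D i t \<notin> crossings D"
proof -
  have "\<forall>\<^sub>F t in at t0. curve D i t \<noteq> z" for z
  proof (cases "curve D i t0 = z")
    case True
    have nz: "norm (vel i t0) > 0" using vel_nonzero assms by simp
    then obtain \<eta> where \<eta>: "\<eta> > 0" "\<And>s t. \<bar>s - t0\<bar> < \<eta> \<Longrightarrow> \<bar>t - t0\<bar> < \<eta> \<Longrightarrow>
      norm (curve D i t - curve D i s - (t - s) *\<^sub>R vel i t0) \<le> norm (vel i t0) / 2 * \<bar>t - s\<bar>"
      using strict_differentiable[OF assms, of "norm (vel i t0) / 2" t0] by (metis half_gt_zero)
    have "curve D i t \<noteq> z" if "\<bar>t - t0\<bar> < \<eta>" "t \<noteq> t0" for t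
    proof
      assume "curve D i t = z"
      then have "\<bar>t - t0\<bar> * norm (vel i t0) \<le> \<bar>t - t0\<bar> * (norm (vel i t0) / 2)"
        using \<eta>(2)[of t0 t] that \<open>\<eta> > 0\<close> True by (simp add: mult.commute)
      then show False using that nz by (simp add: mult_le_cancel_left)
    qed
    then show ?thesis unfolding eventually_at dist_real_def using \<eta>(1) by blast
  next
    case False
    then show ?thesis
      using isCont_curve[OF assms, of t0] tendsto_imp_eventually_ne unfolding isCont_def by blast
  qed
  then have "\<forall>\<^sub>F t in at t0. \<forall>z\<in>crossings D. curve D i t \<noteq> z"
    by (intro eventually_ball_finite finite_crossings) auto
  then show ?thesis by eventually_elim auto
qed

section \<open>Colours on the two sides of a strand\<close>

lemma path_curve: "i < ncomp D \<Longrightarrow> path (curve D i)"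
  by (simp add: path_def continuous_on_curve)

lemma loop_curve: "i < ncomp D \<Longrightarrow> pathfinish (curve D i) = pathstart (curve D i)"
  using curve_add_1[of i 0] by (simp add: pathfinish_def pathstart_def)

lemma path_image_curve: "i < ncomp D \<Longrightarrow> path_image (curve D i) \<subseteq> shadow"
  by (auto simp: path_image_def shadow_def)

lemma even_winding_constant:
  assumes "connected S" "S \<inter> shadow = {}" "x \<in> S" "y \<in> S"
  shows "even_winding x = even_winding y"
proof -
  have "winding_number (curve D i) x = winding_number (curve D i) y" if "i < ncomp D" for i
  proof -
    have "winding_number (curve D i) constant_on S"
      using assms path_image_curve[OF that]
      by (intro winding_number_constant path_curve loop_curve that) auto
    then show ?thesis using assms(3,4) by (metis constant_on_def)
  qed
  then show ?thesis by (simp add: even_winding_def total_winding_def)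
qed

lemma total_winding_Ints: "z \<notin> shadow \<Longrightarrow> total_winding z \<in> \<int>"
  unfolding total_winding_def using path_image_curve
  by (intro Ints_sum integer_winding_number path_curve loop_curve) auto

lemma even_winding_succ:
  assumes "total_winding x = total_winding y + 1" "y \<notin> shadow"
  shows "even_winding x \<longleftrightarrow> \<not> even_winding y"
proof -
  obtain k where k: "total_winding y = of_int k" using total_winding_Ints[OF assms(2)] by (auto elim: Ints_cases)
  have *: "even_winding z \<longleftrightarrow> even m" if "total_winding z = of_int m" for z m
    unfolding even_winding_def that of_int_eq_iff by auto
  have "total_winding x = of_int (k + 1)" using assms(1) k by simp
  then show ?thesis using *[OF k] *[of x "k + 1"] by simp
qed

text \<open>A displacement \<open>w\<close> with a definite normal component cannot be a chord of a
  nearly straight curve. The base parameter \<open>t\<close> varies together with \<open>w\<close>,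
  so a single colour \<open>b\<close> serves all nearby base points; this uniformity later makes
  \<open>left_even\<close> locally constant.\<close>

lemma one_sided_cone:
  assumes i: "i < ncomp D" and nc: "curve D i t0 \<notin> crossings D" and "\<sigma> \<in> {1, -1}" "c > 0"
  obtains \<eta> b where "\<eta> > 0"
    "\<And>t w. \<bar>t - t0\<bar> < \<eta> \<Longrightarrow> norm w < \<eta> \<Longrightarrow> \<sigma> * cross2 (vel i t0) w > c * norm w \<Longrightarrow>
       curve D i t + w \<notin> shadow \<and> even_winding (curve D i t + w) = b"
proof -
  define v where "v = vel i t0"
  define z where "z = curve D i t0"
  have "norm v > 0" using vel_nonzero i by (simp add: v_def)
  \<comment> \<open>Solved from \<open>c' * (norm v + c) = c * norm v\<close>: with this chord error
    the lower and the upper estimate for \<open>c * norm w\<close> at the end of \<open>off\<close>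
    are exactly incompatible.\<close>
  define c' where "c' = c * norm v / (norm v + c)"
  have c': "c' > 0" "c' * norm v = c * norm v - c * c'"
  proof -
    show "c' > 0" using \<open>norm v > 0\<close> \<open>c > 0\<close> by (simp add: c'_def add_pos_pos)
    have "norm v + c \<noteq> 0" using \<open>norm v > 0\<close> \<open>c > 0\<close> by linarith
    then have "c' * (norm v + c) = c * norm v" by (simp add: c'_def)
    then show "c' * norm v = c * norm v - c * c'" by (simp add: algebra_simps)
  qed
  obtain \<eta>1 where \<eta>1: "\<eta>1 > 0" "\<And>s t. \<bar>s - t0\<bar> < \<eta>1 \<Longrightarrow> \<bar>t - t0\<bar> < \<eta>1 \<Longrightarrow>
    norm (curve D i t - curve D i s - (t - s) *\<^sub>R v) \<le> c' * \<bar>t - s\<bar>"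
    using strict_differentiable[OF i c'(1)] unfolding v_def by metis
  obtain r where r: "r > 0"
    "\<And>j t. j < ncomp D \<Longrightarrow> dist (curve D j t) z < r \<Longrightarrow> \<exists>t'. curve D j t' = z \<and> \<bar>t - t'\<bar> < \<eta>1"
    using near_point_preimage[OF \<eta>1(1)] by metis
  obtain \<eta>2 where \<eta>2: "\<eta>2 > 0" "\<And>t. \<bar>t - t0\<bar> < \<eta>2 \<Longrightarrow> dist (curve D i t) z < r / 2"
    using isCont_curve[OF i, of t0] \<open>r > 0\<close>
    unfolding continuous_at_eps_delta dist_real_def z_def by (metis half_gt_zero)
  define \<eta> where "\<eta> = min (min \<eta>1 \<eta>2) (r/2)"
  have \<eta>: "\<eta> > 0" "\<eta> \<le> \<eta>1" "\<eta> \<le> \<eta>2" "\<eta> \<le> r/2" using \<eta>1 \<eta>2 r by (auto simp: \<eta>_def)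
  have off: "curve D i t + w \<notin> shadow"
    if t: "\<bar>t - t0\<bar> < \<eta>" and w: "norm w < \<eta>" "\<sigma> * cross2 v w > c * norm w" for t w
  proof
    assume "curve D i t + w \<in> shadow"
    then obtain j s where j: "j < ncomp D" and s: "curve D j s = curve D i t + w"
      by (auto simp: shadow_def)
    have "dist (curve D i t) z < r / 2" using \<eta>2(2) t \<eta> by simp
    then have "norm (curve D i t - z + w) < r"
      using norm_triangle_ineq[of "curve D i t - z" w] w \<eta> by (simp add: dist_norm)
    then have "dist (curve D j s) z < r" by (simp add: s dist_norm algebra_simps)
    then obtain s' where s': "curve D j s' = z" "\<bar>s - s'\<bar> < \<eta>1" using r(2)[OF j] by blast
    then have "i = j" "frac s' = frac t0"
      using same_strand[OF i j, of t0 s'] nc by (auto simp: z_def)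
    then obtain k where k: "s' = t0 + of_int k" by (elim frac_eqE)
    define u where "u = s - of_int k"
    have u: "\<bar>u - t0\<bar> < \<eta>1" using s'(2) k by (simp add: u_def algebra_simps)
    have eq: "curve D i u = curve D i t + w"
      using curve_add_int[OF i, of u k] s \<open>i = j\<close> by (simp add: u_def)
    define e where "e = w - (u - t) *\<^sub>R v"
    have e: "norm e \<le> c' * \<bar>u - t\<bar>"
      using \<eta>1(2)[of t u] t u \<eta> by (simp add: eq e_def)
    have "c * norm w < \<bar>cross2 v w\<bar>" using w(2) \<open>\<sigma> \<in> {1, -1}\<close> by auto
    \<comment> \<open>\<open>e\<close> differs from \<open>w\<close> by a multiple of
      \<open>v\<close>, which the determinant with \<open>v\<close> does not see; only the chord
      error remains.\<close>
    also have "cross2 v w = cross2 v e" by (simp add: e_def cross2_algebra)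
    also have "\<bar>cross2 v e\<bar> \<le> norm v * (c' * \<bar>u - t\<bar>)"
      using cross2_le_norm[of v e] e by (meson mult_left_mono norm_ge_zero order_trans)
    finally have 1: "c * norm w < c' * norm v * \<bar>u - t\<bar>" by (simp add: ac_simps)
    have "\<bar>u - t\<bar> * norm v \<le> norm w + norm e"
      using norm_triangle_ineq4[of w e] by (simp add: e_def)
    then have "c * (\<bar>u - t\<bar> * norm v) \<le> c * (norm w + c' * \<bar>u - t\<bar>)"
      using e \<open>c > 0\<close> by simp
    moreover have "c' * norm v * \<bar>u - t\<bar> = c * norm v * \<bar>u - t\<bar> - c * c' * \<bar>u - t\<bar>"
      using c'(2) by (simp add: left_diff_distrib)
    ultimately show False using 1 by (simp add: algebra_simps)
  qed
  \<comment> \<open>The cone is convex because the norm is convex and the determinant linear. Hence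
    the image of \<open>K\<close> is connected, misses the shadow and has one colour.\<close>
  define K where "K = ball t0 \<eta> \<times> (ball 0 \<eta> \<inter> {w. c * norm w < \<sigma> * cross2 v w})"
  have "convex {w. c * norm w < \<sigma> * cross2 v w}"
  proof (rule convexI, clarify)
    fix x y :: complex and a b :: real
    assume x: "c * norm x < \<sigma> * cross2 v x" and y: "c * norm y < \<sigma> * cross2 v y"
      and ab: "0 \<le> a" "0 \<le> b" "a + b = 1"
    have "c * norm (a *\<^sub>R x + b *\<^sub>R y) \<le> c * (a * norm x + b * norm y)"
      using norm_triangle_ineq[of "a *\<^sub>R x" "b *\<^sub>R y"] ab \<open>c > 0\<close> by simp
    also have "\<dots> = a * (c * norm x) + b * (c * norm y)" by (simp add: algebra_simps)
    also have "\<dots> < a * (\<sigma> * cross2 v x) + b * (\<sigma> * cross2 v y)"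
    proof (cases "a = 0")
      case False
      then have "a * (c * norm x) < a * (\<sigma> * cross2 v x)" using x ab by simp
      moreover have "b * (c * norm y) \<le> b * (\<sigma> * cross2 v y)" using y ab by (intro mult_left_mono) auto
      ultimately show ?thesis by linarith
    qed (use y ab in simp)
    finally show "c * norm (a *\<^sub>R x + b *\<^sub>R y) < \<sigma> * cross2 v (a *\<^sub>R x + b *\<^sub>R y)"
      by (simp add: cross2_algebra algebra_simps)
  qed
  then have "convex K" unfolding K_def by (intro convex_Times convex_Int) auto
  define F where "F = (\<lambda>(t, w). curve D i t + w)"
  have "continuous_on K F" unfolding F_def case_prod_unfold
    by (intro continuous_intros continuous_on_compose2[OF continuous_on_curve[OF i, of UNIV]]) auto
  then have "connected (F ` K)"
    using \<open>convex K\<close> convex_connected connected_continuous_image by blast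
  moreover have "F ` K \<inter> shadow = {}"
    using off by (auto simp: F_def K_def dist_real_def abs_minus_commute)
  ultimately have const: "\<And>x y. x \<in> F ` K \<Longrightarrow> y \<in> F ` K \<Longrightarrow> even_winding x = even_winding y"
    using even_winding_constant by blast
  show thesis
  proof (rule that[OF \<eta>(1)])
    fix t w assume A: "\<bar>t - t0\<bar> < \<eta>" "norm w < \<eta>" "\<sigma> * cross2 (vel i t0) w > c * norm w"
    have "(t, w) \<in> K" using A by (auto simp: K_def v_def dist_real_def abs_minus_commute)
    then have "curve D i t + w \<in> F ` K" by (force simp: F_def)
    then show "curve D i t + w \<notin> shadow \<and> even_winding (curve D i t + w) = (\<exists>x\<in>F ` K. even_winding x)"
      using off A const unfolding v_def by blast
  qed
qed

text \<open>One family of displaced points from \<open>one_sided_cone\<close> contains both the cone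
  at \<open>t0\<close> and the initial pieces of the left normals at nearby parameters, so all of
  these show the same colour.\<close>

lemma left_cone:
  assumes i: "i < ncomp D" and nc: "curve D i t0 \<notin> crossings D" and c: "c > 0"
  obtains \<eta> where "\<eta> > 0" "\<And>w. norm w < \<eta> \<Longrightarrow> cross2 (vel i t0) w > c * norm w \<Longrightarrow>
       even_winding (curve D i t0 + w) = left_even i t0"
    "\<And>t. \<bar>t - t0\<bar> < \<eta> \<Longrightarrow> left_even i t = left_even i t0"
proof -
  define v where "v = vel i t0"
  have "norm v > 0" using vel_nonzero i by (simp add: v_def)
  \<comment> \<open>The bound \<open>norm v / 2\<close> opens the cone so far that it contains the
    left normal at \<open>t0\<close> and, by continuity of the velocity, those at nearby
    parameters.\<close>
  define c' where "c' = min c (norm v / 2)"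
  have "c' > 0" "c' \<le> c" "c' \<le> norm v / 2" using c \<open>norm v > 0\<close> by (auto simp: c'_def)
  obtain \<eta> b where \<eta>: "\<eta> > 0"
    "\<And>t w. \<bar>t - t0\<bar> < \<eta> \<Longrightarrow> norm w < \<eta> \<Longrightarrow> cross2 v w > c' * norm w \<Longrightarrow> even_winding (curve D i t + w) = b"
    using one_sided_cone[OF i nc, of 1 c'] \<open>c' > 0\<close> unfolding v_def by (metis insertI1 mult_1)
  have "((\<lambda>t. v \<bullet> vel i t - norm v / 2 * norm (vel i t)) \<longlongrightarrow> v \<bullet> v - norm v / 2 * norm v) (at t0)"
    unfolding v_def by (intro tendsto_intros isCont_vel[OF i, unfolded isCont_def])
  moreover have "v \<bullet> v - norm v / 2 * norm v > 0"
    using \<open>norm v > 0\<close> by (simp flip: power2_norm_eq_inner add: power2_eq_square)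
  ultimately have "\<forall>\<^sub>F t in at t0. v \<bullet> vel i t - norm v / 2 * norm (vel i t) > 0"
    by (rule order_tendstoD)
  then obtain \<delta> where \<delta>: "\<delta> > 0" "\<And>t. \<bar>t - t0\<bar> < \<delta> \<Longrightarrow> t \<noteq> t0 \<Longrightarrow> norm v / 2 * norm (vel i t) < v \<bullet> vel i t"
    unfolding eventually_at dist_real_def by auto
  have \<delta>': "norm v / 2 * norm (vel i t) < v \<bullet> vel i t" if "\<bar>t - t0\<bar> < \<delta>" for t
    using \<delta>(2)[OF that] \<open>v \<bullet> v - norm v / 2 * norm v > 0\<close> by (cases "t = t0") (auto simp: v_def)
  have L: "left_even i t = b" if t: "\<bar>t - t0\<bar> < min \<eta> \<delta>" for t
  proof -
    have "((\<lambda>s. norm (s *\<^sub>R (\<i> * vel i t))) \<longlongrightarrow> norm (0 *\<^sub>R (\<i> * vel i t))) (at_right 0)"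
      by (intro tendsto_intros)
    then have "\<forall>\<^sub>F s in at_right 0. norm (s *\<^sub>R (\<i> * vel i t)) < \<eta>"
      by (rule order_tendstoD) (simp add: \<eta>)
    then have "\<forall>\<^sub>F s in at_right 0. even_winding (curve D i t + s *\<^sub>R (\<i> * vel i t)) = b"
      using eventually_at_right_less[of 0]
    proof eventually_elim
      case (elim s)
      have "c' * norm (vel i t) \<le> norm v / 2 * norm (vel i t)"
        using \<open>c' \<le> norm v / 2\<close> by (intro mult_right_mono) auto
      then have "c' * norm (vel i t) < v \<bullet> vel i t" using \<delta>'[of t] t by simp
      then have "s * (c' * norm (vel i t)) < s * (v \<bullet> vel i t)" using elim by simp
      then show ?case
        using \<eta>(2)[of t "s *\<^sub>R (\<i> * vel i t)"] t elim
        by (simp add: cross2_algebra cross2_rotated norm_mult ac_simps)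
    qed
    then show ?thesis unfolding left_even_def by (intro eventually_eq_const) auto
  qed
  have L0: "left_even i t0 = b" using L[of t0] \<eta>(1) \<delta>(1) by simp
  show thesis
  proof (rule that)
    show "min \<eta> \<delta> > 0" using \<eta>(1) \<delta>(1) by simp
    show "left_even i t = left_even i t0" if "\<bar>t - t0\<bar> < min \<eta> \<delta>" for t using L[OF that] L0 by simp
    fix w assume w: "norm w < min \<eta> \<delta>" "cross2 (vel i t0) w > c * norm w"
    have "c' * norm w \<le> c * norm w" using \<open>c' \<le> c\<close> by (intro mult_right_mono) auto
    then show "even_winding (curve D i t0 + w) = left_even i t0"
      using \<eta>(2)[of t0 w] w L0 \<eta>(1) by (simp add: v_def)
  qed
qed

text \<open>Off the crossings only component \<open>i\<close> passes through the point, and its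
  winding number jumps by 1. Every other component keeps its winding number on a small ball, so the
  total jumps by 1 and the parity changes.\<close>

lemma winding_jump:
  assumes i: "i < ncomp D" and nc: "curve D i t0 \<notin> crossings D"
    and offp: "\<forall>\<^sub>F s in at_right 0. curve D i t0 + s *\<^sub>R (\<i> * vel i t0) \<notin> shadow"
    and offm: "\<forall>\<^sub>F s in at_right 0. curve D i t0 - s *\<^sub>R (\<i> * vel i t0) \<notin> shadow"
  shows "\<forall>\<^sub>F s in at_right 0. even_winding (curve D i t0 + s *\<^sub>R (\<i> * vel i t0)) \<longleftrightarrow>
    \<not> even_winding (curve D i t0 - s *\<^sub>R (\<i> * vel i t0))"
proof -
  define n where "n = \<i> * vel i t0"
  define z where "z = curve D i t0"
  have sub: "range (curve D i) \<subseteq> shadow" using i by (auto simp: shadow_def)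
  have own: "\<forall>\<^sub>F s in at_right 0.
    winding_number (curve D i) (z + s *\<^sub>R n) = winding_number (curve D i) (z - s *\<^sub>R n) + 1"
    unfolding z_def
  proof (rule winding_number_jump)
    show "cross2 (vel i t0) n > 0"
      using vel_nonzero[OF i] by (simp add: n_def cross2_rotated)
    show "t - t0 \<in> \<int>" if "curve D i t = curve D i t0" for t
    proof -
      have "frac t = frac t0" using same_strand[OF i i that] that nc by simp
      then show ?thesis by (elim frac_eqE) simp
    qed
    show "\<forall>\<^sub>F s in at_right 0. curve D i t0 + s *\<^sub>R n \<notin> range (curve D i)"
      "\<forall>\<^sub>F s in at_right 0. curve D i t0 - s *\<^sub>R n \<notin> range (curve D i)"
      unfolding n_def by (rule eventually_mono[OF offp], use sub in blast)
        (rule eventually_mono[OF offm], use sub in blast)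
  qed (use i curve_add_1 curve_deriv continuous_on_curve in auto)
  have other: "\<forall>\<^sub>F s in at_right 0.
      winding_number (curve D j) (z + s *\<^sub>R n) = winding_number (curve D j) (z - s *\<^sub>R n)"
    if j: "j < ncomp D" "j \<noteq> i" for j
  proof -
    have "z \<notin> path_image (curve D j)"
    proof
      assume "z \<in> path_image (curve D j)"
      then obtain x where "curve D i t0 = curve D j x" by (auto simp: z_def path_image_def)
      then show False using same_strand[OF i j(1) _ nc] j(2) by blast
    qed
    then obtain \<epsilon> where \<epsilon>: "\<epsilon> > 0" "ball z \<epsilon> \<inter> path_image (curve D j) = {}"
      using closed_path_image[OF path_curve[OF j(1)]]
      by (metis ComplI disjoint_eq_subset_Compl open_Compl open_contains_ball)
    have "winding_number (curve D j) constant_on ball z \<epsilon>"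
      using \<epsilon> by (intro winding_number_constant path_curve loop_curve j) auto
    then have c: "winding_number (curve D j) x = winding_number (curve D j) y"
      if "x \<in> ball z \<epsilon>" "y \<in> ball z \<epsilon>" for x y using that by (metis constant_on_def)
    have "((\<lambda>s. norm (s *\<^sub>R n)) \<longlongrightarrow> norm (0 *\<^sub>R n)) (at_right 0)" by (intro tendsto_intros)
    then have "\<forall>\<^sub>F s in at_right 0. norm (s *\<^sub>R n) < \<epsilon>" by (rule order_tendstoD) (simp add: \<epsilon>)
    then show ?thesis by eventually_elim (rule c, auto simp: dist_norm)
  qed
  have "\<forall>\<^sub>F s in at_right 0. \<forall>j\<in>{..<ncomp D} - {i}.
      winding_number (curve D j) (z + s *\<^sub>R n) = winding_number (curve D j) (z - s *\<^sub>R n)"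
    using other by (intro eventually_ball_finite) auto
  then show ?thesis using own offm unfolding n_def[symmetric] z_def[symmetric]
  proof eventually_elim
    case (elim s)
    have "total_winding (z + s *\<^sub>R n) = total_winding (z - s *\<^sub>R n) + 1"
      unfolding total_winding_def using i elim(1,2)
      by (subst (1 2) sum.remove[of _ i]) auto
    then show ?case using elim by (intro even_winding_succ) auto
  qed
qed

text \<open>The right cone is monochromatic for the same reason as the left one; its colour is
  opposite because the two normal directions lie in the two cones and \<open>winding_jump\<close>
  compares them. The equivalence with \<open>\<sigma> = 1\<close> states both sides at once.\<close>

lemma side_cone:
  assumes i: "i < ncomp D" and nc: "curve D i t0 \<notin> crossings D" and \<sigma>: "\<sigma> \<in> {1, -1}" and c: "c > 0"
  obtains \<eta> where "\<eta> > 0" "\<And>w. norm w < \<eta> \<Longrightarrow> \<sigma> * cross2 (vel i t0) w > c * norm w \<Longrightarrow>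
       even_winding (curve D i t0 + w) \<longleftrightarrow> (left_even i t0 \<longleftrightarrow> \<sigma> = 1)"
proof (cases "\<sigma> = 1")
  case True
  then show ?thesis using left_cone[OF i nc c] that by (metis mult_1)
next
  case False
  then have \<sigma>: "\<sigma> = -1" using \<sigma> by simp
  define v where "v = vel i t0"
  define n where "n = \<i> * v"
  define z where "z = curve D i t0"
  have "norm v > 0" using vel_nonzero i by (simp add: v_def)
  define c' where "c' = min c (norm v / 2)"
  have c': "c' > 0" "c' \<le> c" "c' \<le> norm v / 2" using c \<open>norm v > 0\<close> by (auto simp: c'_def)
  obtain \<eta>1 b1 where \<eta>1: "\<eta>1 > 0"
    "\<And>t w. \<bar>t - t0\<bar> < \<eta>1 \<Longrightarrow> norm w < \<eta>1 \<Longrightarrow> 1 * cross2 (vel i t0) w > c' * norm w \<Longrightarrow>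
       curve D i t + w \<notin> shadow \<and> even_winding (curve D i t + w) = b1"
    by (rule one_sided_cone[OF i nc _ c'(1), of 1]) auto
  obtain \<eta> b where \<eta>: "\<eta> > 0"
    "\<And>t w. \<bar>t - t0\<bar> < \<eta> \<Longrightarrow> norm w < \<eta> \<Longrightarrow> (-1) * cross2 (vel i t0) w > c' * norm w \<Longrightarrow>
       curve D i t + w \<notin> shadow \<and> even_winding (curve D i t + w) = b"
    by (rule one_sided_cone[OF i nc _ c'(1), of "-1"]) auto
  have plus: "z + w \<notin> shadow" if "norm w < \<eta>1" "c' * norm w < cross2 v w" for w
    using \<eta>1(2)[of t0 w] \<eta>1(1) that by (simp add: z_def v_def)
  have minus: "z + w \<notin> shadow \<and> even_winding (z + w) = b"
    if "norm w < \<eta>" "c' * norm w < - cross2 v w" for w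
    using \<eta>(2)[of t0 w] \<eta>(1) that by (simp add: z_def v_def)
  have cone: "c' * norm (s *\<^sub>R n) < cross2 v (s *\<^sub>R n)" if "s > 0" for s
  proof -
    have "c' * norm v < norm v * norm v" using c' \<open>norm v > 0\<close> by simp
    then have "s * (c' * norm v) < s * (norm v * norm v)" using that by simp
    then show ?thesis using that
      by (simp add: n_def cross2_algebra cross2_rotated norm_mult power2_norm_eq_inner[symmetric]
          power2_eq_square ac_simps)
  qed
  have "((\<lambda>s. norm (s *\<^sub>R n)) \<longlongrightarrow> norm (0 *\<^sub>R n)) (at_right 0)" by (intro tendsto_intros)
  then have "\<forall>\<^sub>F s in at_right 0. norm (s *\<^sub>R n) < min \<eta> \<eta>1"
    by (rule order_tendstoD) (simp add: \<eta>(1) \<eta>1(1))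
  then have ev: "\<forall>\<^sub>F s in at_right 0. norm (s *\<^sub>R n) < min \<eta> \<eta>1 \<and> s > 0"
    using eventually_at_right_less[of 0] by (rule eventually_conj)
  then have p: "\<forall>\<^sub>F s in at_right 0. z + s *\<^sub>R n \<notin> shadow"
    by eventually_elim (use plus cone in auto)
  have m: "z - s *\<^sub>R n \<notin> shadow \<and> even_winding (z - s *\<^sub>R n) = b"
    if "norm (s *\<^sub>R n) < min \<eta> \<eta>1 \<and> s > 0" for s
    using minus[of "- (s *\<^sub>R n)"] cone[of s] that cross2_algebra(2)[of v 0 "s *\<^sub>R n"]
    by (auto simp: cross2_algebra(7))
  have "\<forall>\<^sub>F s in at_right 0. even_winding (z + s *\<^sub>R n) \<longleftrightarrow> \<not> even_winding (z - s *\<^sub>R n)"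
    unfolding z_def n_def v_def
  proof (rule winding_jump[OF i nc])
    show "\<forall>\<^sub>F s in at_right 0. curve D i t0 + s *\<^sub>R (\<i> * vel i t0) \<notin> shadow"
      using p by (simp add: z_def n_def v_def)
    show "\<forall>\<^sub>F s in at_right 0. curve D i t0 - s *\<^sub>R (\<i> * vel i t0) \<notin> shadow"
      using eventually_mono[OF ev conjunct1[OF m]] by (simp add: z_def n_def v_def)
  qed
  then have "\<forall>\<^sub>F s in at_right 0. even_winding (z + s *\<^sub>R n) = (\<not> b)"
    using ev by eventually_elim (use m in auto)
  then have "left_even i t0 = (\<not> b)"
    unfolding left_even_def z_def n_def v_def by (intro eventually_eq_const) auto
  show ?thesis
  proof (rule that[OF \<eta>(1)])
    fix w assume w: "norm w < \<eta>" "\<sigma> * cross2 (vel i t0) w > c * norm w"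
    have "c' * norm w \<le> c * norm w" using c' by (intro mult_right_mono) auto
    then have "even_winding (z + w) = b" using minus[OF w(1)] w(2) by (simp add: \<sigma> v_def)
    then show "even_winding (curve D i t0 + w) \<longleftrightarrow> (left_even i t0 \<longleftrightarrow> \<sigma> = 1)"
      using \<open>left_even i t0 = (\<not> b)\<close> by (simp add: \<sigma> z_def)
  qed
qed

section \<open>Colours of the sectors at a crossing\<close>

text \<open>A displacement with one-sided derivative \<open>u\<close> at 0 eventually enters every
  cone around \<open>u\<close>. If \<open>u\<close> points to the side \<open>\<sigma>\<close>, the
  displaced point therefore shows the colour of that side.\<close>

lemma approach_side:
  assumes i: "i < ncomp D" and nc: "curve D i t \<notin> crossings D" and \<sigma>: "\<sigma> \<in> {1, -1}"
    and lim: "((\<lambda>y. \<delta> y /\<^sub>R y) \<longlongrightarrow> u) (at_right 0)" and pos: "\<sigma> * cross2 (vel i t) u > 0"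
  shows "\<forall>\<^sub>F y in at_right 0. even_winding (curve D i t + \<delta> y) \<longleftrightarrow> (left_even i t \<longleftrightarrow> \<sigma> = 1)"
proof -
  define K where "K = \<sigma> * cross2 (vel i t) u"
  \<comment> \<open>By this choice \<open>K - c * norm u\<close> equals \<open>c\<close>, so the
    cone contains \<open>u\<close> with room to spare.\<close>
  define c where "c = K / (norm u + 1)"
  have "norm u + 1 > 0" by (smt (verit) norm_ge_zero)
  then have "c > 0" using pos by (simp add: c_def K_def)
  have "c * (norm u + 1) = K" using \<open>norm u + 1 > 0\<close> by (simp add: c_def)
  then have gap: "K - c * norm u > 0" using \<open>c > 0\<close> by (simp add: algebra_simps)
  obtain \<eta> where \<eta>: "\<eta> > 0" "\<And>w. norm w < \<eta> \<Longrightarrow> \<sigma> * cross2 (vel i t) w > c * norm w \<Longrightarrow>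
       even_winding (curve D i t + w) \<longleftrightarrow> (left_even i t \<longleftrightarrow> \<sigma> = 1)"
    using side_cone[OF i nc \<sigma> \<open>c > 0\<close>] by blast
  have "((\<lambda>y. norm (y *\<^sub>R (\<delta> y /\<^sub>R y))) \<longlongrightarrow> norm (0 *\<^sub>R u)) (at_right 0)"
    by (intro tendsto_intros lim)
  then have "\<forall>\<^sub>F y in at_right 0. norm (y *\<^sub>R (\<delta> y /\<^sub>R y)) < \<eta>"
    by (rule order_tendstoD) (simp add: \<eta>)
  moreover have "((\<lambda>y. \<sigma> * cross2 (vel i t) (\<delta> y /\<^sub>R y) - c * norm (\<delta> y /\<^sub>R y)) \<longlongrightarrow> K - c * norm u) (at_right 0)"
    unfolding K_def by (intro tendsto_intros lim)
  then have "\<forall>\<^sub>F y in at_right 0. \<sigma> * cross2 (vel i t) (\<delta> y /\<^sub>R y) - c * norm (\<delta> y /\<^sub>R y) > 0"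
    by (rule order_tendstoD) (rule gap)
  ultimately show ?thesis using eventually_at_right_less[of 0]
  proof eventually_elim
    case (elim y)
    have "y * (c * norm (\<delta> y /\<^sub>R y)) < y * (\<sigma> * cross2 (vel i t) (\<delta> y /\<^sub>R y))" using elim by simp
    then show ?case using elim by (intro \<eta>(2)) (simp_all add: cross2_algebra)
  qed
qed

text \<open>
  The four sectors at a crossing are parametrized by translating one strand along the other one;
  such a translate meets neither strand because the crossing is transversal.
\<close>

lemma sector_parity:
  assumes i: "i < ncomp D" and j: "j < ncomp D"
    and z: "curve D i t0 = z" "curve D j t1 = z" and ne: "\<not> (i = j \<and> frac t0 = frac t1)"
    and a: "a \<in> {1, -1}" and b: "b \<in> {1, -1}"
  obtains \<eta> \<beta> where "\<eta> > 0" "\<And>x y. 0 < x \<Longrightarrow> x < \<eta> \<Longrightarrow> 0 < y \<Longrightarrow> y < \<eta> \<Longrightarrow>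
     even_winding (curve D i (t0 + a * x) + (curve D j (t1 + b * y) - z)) = \<beta>"
proof -
  define v where "v = vel i t0"
  define v' where "v' = vel j t1"
  define \<Delta> where "\<Delta> = \<bar>cross2 v v'\<bar>"
  have "\<Delta> > 0" using crossing_transversal[OF i j z ne] by (simp add: \<Delta>_def v_def v'_def)
  have "norm v + norm v' > 0" using vel_nonzero[OF i] by (simp add: v_def add_pos_nonneg)
  define N where "N = norm v + norm v'"
  \<comment> \<open>With this value the chord errors use at most half of the bound in
    \<open>norm_transversal_combination\<close>; the other half forces both coefficients in
    \<open>key\<close> to vanish.\<close>
  define c where "c = \<Delta> / N / 2"
  have c: "c > 0" "c * (norm v + norm v') = \<Delta> / 2"
    using \<open>\<Delta> > 0\<close> \<open>norm v + norm v' > 0\<close> unfolding N_def[symmetric] by (simp_all add: c_def)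
  have key: "p = 0 \<and> \<tau> = 0"
    if "norm (A - p *\<^sub>R v') \<le> c * \<bar>p\<bar>" "norm (A - \<tau> *\<^sub>R v) \<le> c * \<bar>\<tau>\<bar>" for A p \<tau>
  proof -
    have "p *\<^sub>R v' - \<tau> *\<^sub>R v = (A - \<tau> *\<^sub>R v) - (A - p *\<^sub>R v')" by simp
    then have "norm (p *\<^sub>R v' - \<tau> *\<^sub>R v) \<le> c * \<bar>\<tau>\<bar> + c * \<bar>p\<bar>"
      using that norm_triangle_ineq4[of "A - \<tau> *\<^sub>R v" "A - p *\<^sub>R v'"] by simp
    then have "(norm v + norm v') * norm (p *\<^sub>R v' - \<tau> *\<^sub>R v) \<le> (norm v + norm v') * (c * \<bar>\<tau>\<bar> + c * \<bar>p\<bar>)"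
      using \<open>norm v + norm v' > 0\<close> by simp
    also have "\<dots> = c * (norm v + norm v') * (\<bar>p\<bar> + \<bar>\<tau>\<bar>)" by (simp add: algebra_simps)
    finally have "\<Delta> * (\<bar>p\<bar> + \<bar>\<tau>\<bar>) \<le> \<Delta> / 2 * (\<bar>p\<bar> + \<bar>\<tau>\<bar>)"
      using norm_transversal_combination[of v v' p \<tau>] c(2) by (simp add: \<Delta>_def)
    then have "\<Delta> * (\<bar>p\<bar> + \<bar>\<tau>\<bar>) \<le> 0" by simp
    then have "\<bar>p\<bar> + \<bar>\<tau>\<bar> \<le> 0" using \<open>\<Delta> > 0\<close> by (simp only: mult_le_0_iff) auto
    then show ?thesis by linarith
  qed
  obtain \<eta>1 where \<eta>1: "\<eta>1 > 0" "\<And>s t. \<bar>s - t0\<bar> < \<eta>1 \<Longrightarrow> \<bar>t - t0\<bar> < \<eta>1 \<Longrightarrow>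
    norm (curve D i t - curve D i s - (t - s) *\<^sub>R v) \<le> c * \<bar>t - s\<bar>"
    using strict_differentiable[OF i c(1)] unfolding v_def by metis
  obtain \<eta>2 where \<eta>2: "\<eta>2 > 0" "\<And>s t. \<bar>s - t1\<bar> < \<eta>2 \<Longrightarrow> \<bar>t - t1\<bar> < \<eta>2 \<Longrightarrow>
    norm (curve D j t - curve D j s - (t - s) *\<^sub>R v') \<le> c * \<bar>t - s\<bar>"
    using strict_differentiable[OF j c(1)] unfolding v'_def by metis
  define \<eta>0 where "\<eta>0 = min \<eta>1 \<eta>2"
  have "\<eta>0 > 0" using \<eta>1 \<eta>2 by (simp add: \<eta>0_def)
  then obtain r where r: "r > 0"
    "\<And>k t. k < ncomp D \<Longrightarrow> dist (curve D k t) z < r \<Longrightarrow> \<exists>t'. curve D k t' = z \<and> \<bar>t - t'\<bar> < \<eta>0"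
    using near_point_preimage by metis
  obtain \<delta>1 where \<delta>1: "\<delta>1 > 0" "\<And>t. \<bar>t - t0\<bar> < \<delta>1 \<Longrightarrow> dist (curve D i t) z < r / 2"
    using isCont_curve[OF i, of t0] \<open>r > 0\<close>
    unfolding continuous_at_eps_delta dist_real_def z by (metis half_gt_zero)
  obtain \<delta>2 where \<delta>2: "\<delta>2 > 0" "\<And>t. \<bar>t - t1\<bar> < \<delta>2 \<Longrightarrow> dist (curve D j t) z < r / 2"
    using isCont_curve[OF j, of t1] \<open>r > 0\<close>
    unfolding continuous_at_eps_delta dist_real_def z by (metis half_gt_zero)
  define \<eta> where "\<eta> = min \<eta>0 (min \<delta>1 \<delta>2)"
  have \<eta>: "\<eta> > 0" "\<eta> \<le> \<eta>1" "\<eta> \<le> \<eta>2" "\<eta> \<le> \<delta>1" "\<eta> \<le> \<delta>2"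
    using \<open>\<eta>0 > 0\<close> \<delta>1 \<delta>2 by (auto simp: \<eta>_def \<eta>0_def)
  define F where "F = (\<lambda>(x, y). curve D i (t0 + a * x) + (curve D j (t1 + b * y) - z))"
  have off: "F (x, y) \<notin> shadow" if x: "0 < x" "x < \<eta>" and y: "0 < y" "y < \<eta>" for x y
  proof
    define P where "P = F (x, y)"
    assume "F (x, y) \<in> shadow"
    then obtain k s where k: "k < ncomp D" and s: "curve D k s = P"
      by (auto simp: shadow_def P_def)
    have ax: "\<bar>(t0 + a * x) - t0\<bar> < \<eta>" using a x by auto
    have bY: "\<bar>(t1 + b * y) - t1\<bar> < \<eta>" using b y by auto
    have "norm (curve D i (t0 + a * x) - z) < r / 2" "norm (curve D j (t1 + b * y) - z) < r / 2"
      using \<delta>1(2)[of "t0 + a * x"] \<delta>2(2)[of "t1 + b * y"] ax bY \<eta> by (simp_all add: dist_norm)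
    then have "norm ((curve D i (t0 + a * x) - z) + (curve D j (t1 + b * y) - z)) < r"
      by (smt (verit) norm_triangle_ineq field_sum_of_halves)
    then have "dist (curve D k s) z < r" by (simp add: s P_def F_def dist_norm algebra_simps)
    then obtain s' where s': "curve D k s' = z" "\<bar>s - s'\<bar> < \<eta>0" using r(2)[OF k] by blast
    from crossing_strands[OF i j k z s'(1) ne]
    consider "k = i" "frac s' = frac t0" | "k = j" "frac s' = frac t1" by blast
    then show False
    proof cases
      case 1
      then obtain m where m: "s' = t0 + of_int m" by (elim frac_eqE)
      define u where "u = s - of_int m"
      have u: "\<bar>u - t0\<bar> < \<eta>1" using s'(2) m by (simp add: u_def \<eta>0_def algebra_simps)
      have eq: "curve D i u = P" using curve_add_int[OF i, of u m] s 1 by (simp add: u_def)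
      \<comment> \<open>If the translated point lay on strand \<open>i\<close>, the displacement
        along strand \<open>j\<close> would also be a chord of strand \<open>i\<close>, hence nearly
        parallel to both tangents. By \<open>key\<close> it would then have parameter 0. The other
        case exchanges the strands.\<close>
      have "norm ((curve D j (t1 + b * y) - z) - (b * y) *\<^sub>R v') \<le> c * \<bar>b * y\<bar>"
        using \<eta>2(2)[of t1 "t1 + b * y"] bY \<eta> z by simp
      moreover have "norm ((curve D j (t1 + b * y) - z) - (u - (t0 + a * x)) *\<^sub>R v) \<le> c * \<bar>u - (t0 + a * x)\<bar>"
        using \<eta>1(2)[of "t0 + a * x" u] u ax \<eta> by (simp add: eq P_def F_def)
      ultimately have "b * y = 0" using key by blast
      then show False using b y by auto
    next
      case 2
      then obtain m where m: "s' = t1 + of_int m" by (elim frac_eqE)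
      define u where "u = s - of_int m"
      have u: "\<bar>u - t1\<bar> < \<eta>2" using s'(2) m by (simp add: u_def \<eta>0_def algebra_simps)
      have eq: "curve D j u = P" using curve_add_int[OF j, of u m] s 2 by (simp add: u_def)
      have "norm ((curve D i (t0 + a * x) - z) - (a * x) *\<^sub>R v) \<le> c * \<bar>a * x\<bar>"
        using \<eta>1(2)[of t0 "t0 + a * x"] ax \<eta> z by simp
      moreover have "norm ((curve D i (t0 + a * x) - z) - (u - (t1 + b * y)) *\<^sub>R v') \<le> c * \<bar>u - (t1 + b * y)\<bar>"
        using \<eta>2(2)[of "t1 + b * y" u] u bY \<eta> by (simp add: eq P_def F_def algebra_simps)
      ultimately have "a * x = 0" using key by blast
      then show False using a x by auto
    qed
  qed
  define Q where "Q = {0<..<\<eta>} \<times> {0<..<\<eta>}"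
  have "continuous_on Q F" unfolding F_def case_prod_unfold
    by (intro continuous_intros continuous_on_compose2[OF continuous_on_curve[OF i, of UNIV]]
        continuous_on_compose2[OF continuous_on_curve[OF j, of UNIV]]) auto
  moreover have "connected Q" unfolding Q_def
    by (intro convex_connected convex_Times) auto
  ultimately have "connected (F ` Q)" using connected_continuous_image by blast
  moreover have "F ` Q \<inter> shadow = {}" using off by (auto simp: Q_def)
  ultimately have const: "\<And>x y. x \<in> F ` Q \<Longrightarrow> y \<in> F ` Q \<Longrightarrow> even_winding x = even_winding y"
    using even_winding_constant by blast
  show thesis
  proof (rule that[OF \<eta>(1)])
    fix x y assume "0 < x" "x < \<eta>" "0 < y" "y < \<eta>"
    then have "F (x, y) \<in> F ` Q" by (simp add: Q_def)
    moreover have "F (\<eta> / 2, \<eta> / 2) \<in> F ` Q" using \<eta>(1) by (simp add: Q_def)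
    ultimately have "even_winding (F (x, y)) = even_winding (F (\<eta> / 2, \<eta> / 2))" by (rule const)
    then show "even_winding (curve D i (t0 + a * x) + (curve D j (t1 + b * y) - z)) =
      even_winding (F (\<eta> / 2, \<eta> / 2))" by (simp add: F_def)
  qed
qed

lemma filterlim_ray: 
  fixes t a :: real
  assumes "a \<in> {1, -1}" shows "filterlim (\<lambda>x. t + a * x) (at t) (at_right 0)"
proof (rule filterlim_atI)
  show "((\<lambda>x. t + a * x) \<longlongrightarrow> t) (at_right 0)" by (auto intro!: tendsto_eq_intros)
  show "\<forall>\<^sub>F x in at_right 0. t + a * x \<noteq> t"
    using eventually_at_right_less[of 0] by eventually_elim (use assms in auto)
qed

text \<open>With \<open>x\<close> fixed and \<open>y\<close> tending to 0, the sector point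
  approaches strand \<open>i\<close> at \<open>t0 + a * x\<close> from the side to which the ray
  \<open>b\<close> of strand \<open>j\<close> points. The constant colour \<open>\<beta>\<close> of
  the sector is then the colour of that side; by continuity of the velocity the side is the same for
  all small \<open>x\<close>.\<close>

lemma left_even_from_sector:
  assumes i: "i < ncomp D" and j: "j < ncomp D"
    and z: "curve D j t1 = z" and a: "a \<in> {1, -1}" and b: "b \<in> {1, -1}"
    and \<sigma>: "\<sigma> \<in> {1, -1}" "\<sigma> * (b * cross2 (vel i t0) (vel j t1)) > 0"
    and \<eta>: "\<eta> > 0" "\<And>x y. 0 < x \<Longrightarrow> x < \<eta> \<Longrightarrow> 0 < y \<Longrightarrow> y < \<eta> \<Longrightarrow>
     even_winding (curve D i (t0 + a * x) + (curve D j (t1 + b * y) - z)) = \<beta>"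
  shows "\<forall>\<^sub>F x in at_right 0. left_even i (t0 + a * x) \<longleftrightarrow> (\<beta> \<longleftrightarrow> \<sigma> = 1)"
proof -
  define u where "u = b *\<^sub>R vel j t1"
  have lim: "((\<lambda>y. (curve D j (t1 + b * y) - z) /\<^sub>R y) \<longlongrightarrow> u) (at_right 0)"
  proof -
    have "((\<lambda>y. curve D j (t1 + b * y)) has_vector_derivative b *\<^sub>R vel j t1) (at 0)"
    proof -
      have "(curve D j \<circ> (\<lambda>y. t1 + b * y) has_vector_derivative b *\<^sub>R vel j t1) (at 0)"
        by (rule vector_diff_chain_at) (auto intro!: derivative_eq_intros curve_deriv j)
      then show ?thesis by (simp add: o_def)
    qed
    then have "((\<lambda>y. curve D j (t1 + b * y)) has_vector_derivative u) (at 0 within {0<..})"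
      unfolding u_def by (rule has_vector_derivative_at_within)
    then have "((\<lambda>y. (1 / norm y) *\<^sub>R (curve D j (t1 + b * y) - (z + y *\<^sub>R u))) \<longlongrightarrow> 0) (at_right 0)"
      unfolding has_vector_derivative_def has_derivative_within by (simp add: z)
    then have "((\<lambda>y. (curve D j (t1 + b * y) - z) /\<^sub>R y - u) \<longlongrightarrow> 0) (at_right 0)"
    proof (rule Lim_transform_eventually)
      show "\<forall>\<^sub>F y in at_right 0. (1 / norm y) *\<^sub>R (curve D j (t1 + b * y) - (z + y *\<^sub>R u)) =
          (curve D j (t1 + b * y) - z) /\<^sub>R y - u"
        using eventually_at_right_less[of 0]
        by eventually_elim (simp add: scaleR_right_diff_distrib scaleR_right_distrib divide_inverse)
    qed
    then show ?thesis by (rule LIM_zero_cancel)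
  qed
  have "((\<lambda>x. \<sigma> * cross2 (vel i (t0 + a * x)) u) \<longlongrightarrow> \<sigma> * cross2 (vel i t0) u) (at_right 0)"
    by (intro tendsto_intros isCont_tendsto_compose[of t0 "vel i", OF isCont_vel[OF i]])
       (auto intro!: tendsto_eq_intros)
  moreover have "\<sigma> * cross2 (vel i t0) u > 0" using \<sigma>(2) by (simp add: u_def cross2_algebra)
  ultimately have "\<forall>\<^sub>F x in at_right 0. \<sigma> * cross2 (vel i (t0 + a * x)) u > 0"
    by (rule order_tendstoD)
  moreover have "\<forall>\<^sub>F x in at_right 0. curve D i (t0 + a * x) \<notin> crossings D"
    using eventually_noncrossing[OF i] filterlim_ray[OF a, of t0] by (rule eventually_compose_filterlim)
  moreover have "\<forall>\<^sub>F x in at_right 0. x < \<eta>" using \<eta>(1) by (auto intro: eventually_at_rightI)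
  ultimately show ?thesis using eventually_at_right_less[of 0]
  proof eventually_elim
    case (elim x)
    have "\<forall>\<^sub>F y in at_right 0. even_winding (curve D i (t0 + a * x) + (curve D j (t1 + b * y) - z)) \<longleftrightarrow>
        (left_even i (t0 + a * x) \<longleftrightarrow> \<sigma> = 1)"
      by (rule approach_side[OF i elim(2) \<sigma>(1) lim elim(1)])
    moreover have "\<forall>\<^sub>F y in at_right 0. y < \<eta>" using \<eta>(1) by (auto intro: eventually_at_rightI)
    ultimately have "\<forall>\<^sub>F y in at_right (0::real). \<beta> \<longleftrightarrow> (left_even i (t0 + a * x) \<longleftrightarrow> \<sigma> = 1)"
      using eventually_at_right_less[of 0]
      by eventually_elim (use \<eta>(2) elim in auto)
    then show ?case by (auto simp: eventually_const)
  qed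
qed

text \<open>The sector between the two rays borders both strands. By antisymmetry of the determinant
  it lies on side \<open>b * sgn K\<close> of strand \<open>i\<close> and on side
  \<open>- a * sgn K\<close> of strand \<open>j\<close>, and these signs agree exactly when
  \<open>a\<close> and \<open>b\<close> differ.\<close>

lemma left_even_at_crossing:
  assumes i: "i < ncomp D" and j: "j < ncomp D"
    and z: "curve D i t0 = z" "curve D j t1 = z" and ne: "\<not> (i = j \<and> frac t0 = frac t1)"
    and a: "a \<in> {1, -1}" and b: "b \<in> {1, -1}"
  shows "\<forall>\<^sub>F x in at_right 0. left_even i (t0 + a * x) = left_even j (t1 + b * x) \<longleftrightarrow> a \<noteq> b"
proof -
  obtain \<eta> \<beta> where \<eta>: "\<eta> > 0" "\<And>x y. 0 < x \<Longrightarrow> x < \<eta> \<Longrightarrow> 0 < y \<Longrightarrow> y < \<eta> \<Longrightarrow>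
     even_winding (curve D i (t0 + a * x) + (curve D j (t1 + b * y) - z)) = \<beta>"
    using sector_parity[OF assms] by metis
  define K where "K = cross2 (vel i t0) (vel j t1)"
  have "K \<noteq> 0" using crossing_transversal[OF i j z ne] by (simp add: K_def)
  have K': "cross2 (vel j t1) (vel i t0) = - K" by (simp add: K_def cross2_swap[of "vel j t1"])
  have "\<forall>\<^sub>F x in at_right 0. left_even i (t0 + a * x) \<longleftrightarrow> (\<beta> \<longleftrightarrow> b * sgn K = 1)"
    using \<open>K \<noteq> 0\<close> a b
    by (intro left_even_from_sector[OF i j z(2) a b _ _ \<eta>]) (auto simp: K_def[symmetric] sgn_if)
  moreover have "\<forall>\<^sub>F x in at_right 0. left_even j (t1 + b * x) \<longleftrightarrow> (\<beta> \<longleftrightarrow> - a * sgn K = 1)"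
    using \<open>K \<noteq> 0\<close> a b
  proof (intro left_even_from_sector[OF j i z(1) b a _ _ \<eta>(1)])
    show "even_winding (curve D j (t1 + b * x) + (curve D i (t0 + a * y) - z)) = \<beta>"
      if "0 < x" "x < \<eta>" "0 < y" "y < \<eta>" for x y
      using \<eta>(2)[OF that(3,4,1,2)] by (simp add: algebra_simps)
  qed (auto simp: K' sgn_if)
  ultimately show ?thesis
    by eventually_elim (use \<open>K \<noteq> 0\<close> a b in \<open>auto simp: sgn_if\<close>)
qed

section \<open>Labelling the arcs\<close>

lemma left_even_locally_constant:
  assumes "i < ncomp D" "curve D i t \<notin> crossings D"
  shows "\<exists>\<eta>>0. \<forall>x. \<bar>x - t\<bar> < \<eta> \<longrightarrow> left_even i x = left_even i t"
  by (rule left_cone[OF assms zero_less_one]) blast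

text \<open>At the parameter of a crossing the point lies outside the underlying set and the value
  is the empty set, not an arc.\<close>

definition "arc_at i t = connected_component_set (shadow - crossings D) (curve D i t)"

lemma arcs_eq: "arcs D = components (shadow - crossings D)"
  by (simp add: arcs_def shadow_def)

lemma curve_in_shadow: "i < ncomp D \<Longrightarrow> curve D i t \<in> shadow"
  by (auto simp: shadow_def)

lemma arc_at_arcs: "i < ncomp D \<Longrightarrow> curve D i t \<notin> crossings D \<Longrightarrow> arc_at i t \<in> arcs D"
  unfolding arcs_eq arc_at_def using curve_in_shadow by (auto intro: componentsI)

lemma curve_in_arc_at: "i < ncomp D \<Longrightarrow> curve D i t \<notin> crossings D \<Longrightarrow> curve D i t \<in> arc_at i t"
  unfolding arc_at_def using curve_in_shadow by simp

lemma arcsE: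
  assumes "C \<in> arcs D"
  obtains i t where "i < ncomp D" "curve D i t \<notin> crossings D" "C = arc_at i t"
proof -
  obtain z where "z \<in> shadow - crossings D" "C = connected_component_set (shadow - crossings D) z"
    using assms unfolding arcs_eq by (auto elim: componentsE)
  then show thesis using that by (auto simp: arc_at_def shadow_def)
qed

lemma arc_at_unique: "C \<in> arcs D \<Longrightarrow> curve D i t \<in> C \<Longrightarrow> C = arc_at i t"
  unfolding arcs_eq arc_at_def by (elim componentsE) (metis connected_component_eq)

lemma arc_at_interval:
  assumes i: "i < ncomp D" and S: "connected S" "s \<in> S" "t \<in> S"
    and "\<And>x. x \<in> S \<Longrightarrow> curve D i x \<notin> crossings D"
  shows "arc_at i s = arc_at i t"
proof -
  have "connected (curve D i ` S)"
    by (intro connected_continuous_image continuous_on_curve i S)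
  moreover have "curve D i ` S \<subseteq> shadow - crossings D"
    using assms(5) curve_in_shadow[OF i] by auto
  ultimately have "connected_component (shadow - crossings D) (curve D i s) (curve D i t)"
    unfolding connected_component_def using S by blast
  then show ?thesis unfolding arc_at_def
    by (intro connected_component_eq[symmetric]) simp
qed

text \<open>This justifies the definite description in \<open>end_arc\<close>: a short open ray of
  parameters avoids the crossings, and its connected image lies in a single component.\<close>

lemma end_arc:
  assumes i: "i < ncomp D" and d: "d \<in> {1, -1}"
  shows end_arc_in_arcs: "end_arc D (i, t) d \<in> arcs D"
    and eventually_arc_at: "\<forall>\<^sub>F e in at_right 0. curve D i (t + d * e) \<notin> crossings D \<and>
      arc_at i (t + d * e) = end_arc D (i, t) d"
proof -
  have "\<forall>\<^sub>F e in at_right 0. curve D i (t + d * e) \<notin> crossings D"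
    using eventually_noncrossing[OF i] filterlim_ray[OF d, of t] by (rule eventually_compose_filterlim)
  then obtain \<eta> where \<eta>: "\<eta> > 0" "\<And>e. 0 < e \<Longrightarrow> e < \<eta> \<Longrightarrow> curve D i (t + d * e) \<notin> crossings D"
    unfolding eventually_at_right_field by auto
  define C where "C = arc_at i (t + d * (\<eta> / 2))"
  have C: "C \<in> arcs D" unfolding C_def using \<eta>(1) by (intro arc_at_arcs i \<eta>(2)) auto
  have same: "arc_at i (t + d * e) = C" if "0 < e" "e < \<eta>" for e
    unfolding C_def
  proof (rule arc_at_interval[OF i])
    show "connected ((\<lambda>e. t + d * e) ` {0<..<\<eta>})"
      by (intro connected_continuous_image continuous_intros) auto
    show "t + d * e \<in> (\<lambda>e. t + d * e) ` {0<..<\<eta>}" using that by (intro imageI) simp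
    show "t + d * (\<eta> / 2) \<in> (\<lambda>e. t + d * e) ` {0<..<\<eta>}" using \<eta>(1) by (intro imageI) simp
  qed (use \<eta>(2) in auto)
  have ev: "\<forall>\<^sub>F e in at_right 0. 0 < e \<and> e < \<eta>"
    using \<eta>(1) by (auto intro: eventually_at_rightI)
  have "end_arc D (i, t) d = C"
    unfolding end_arc_def
  proof (rule the_equality)
    have "\<forall>\<^sub>F e in at_right 0. curve D i (t + d * e) \<in> C"
      using ev by eventually_elim (use same \<eta>(2) curve_in_arc_at[OF i] in metis)
    then show "C \<in> arcs D \<and> (\<forall>\<^sub>F e in at_right 0. curve D (fst (i, t)) (snd (i, t) + d * e) \<in> C)"
      using C by simp
  next
    fix C' assume "C' \<in> arcs D \<and> (\<forall>\<^sub>F e in at_right 0. curve D (fst (i, t)) (snd (i, t) + d * e) \<in> C')"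
    then have C': "C' \<in> arcs D" "\<forall>\<^sub>F e in at_right 0. curve D i (t + d * e) \<in> C'" by auto
    have "\<forall>\<^sub>F e in at_right (0::real). C' = C"
      using C'(2) ev by eventually_elim (use same C'(1) arc_at_unique in metis)
    then show "C' = C" by (simp add: eventually_const)
  qed
  then show "end_arc D (i, t) d \<in> arcs D"
    and "\<forall>\<^sub>F e in at_right 0. curve D i (t + d * e) \<notin> crossings D \<and> arc_at i (t + d * e) = end_arc D (i, t) d"
    using C eventually_mono[OF ev] same \<eta>(2) by auto
qed

lemma end_arc_frac:
  assumes "i < ncomp D" shows "end_arc D (i, frac t) d = end_arc D (i, t) d"
proof -
  have "curve D i (frac t + x) = curve D i (t + x)" for x
    using curve_add_int[OF assms, of "t + x" "- \<lfloor>t\<rfloor>"] by (simp add: frac_def algebra_simps)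
  then show ?thesis by (simp add: end_arc_def)
qed

lemma arc_at_locally_constant:
  assumes i: "i < ncomp D" and nc: "curve D i t \<notin> crossings D"
  shows "\<forall>\<^sub>F x in at t. arc_at i x = arc_at i t"
proof -
  obtain \<eta> where \<eta>: "\<eta> > 0" "\<And>x. x \<noteq> t \<Longrightarrow> dist x t < \<eta> \<Longrightarrow> curve D i x \<notin> crossings D"
    using eventually_noncrossing[OF i, of t] unfolding eventually_at by auto
  have "arc_at i x = arc_at i t" if "dist x t < \<eta>" for x
  proof (rule arc_at_interval[OF i, of "ball t \<eta>"])
    show "curve D i x \<notin> crossings D" if "x \<in> ball t \<eta>" for x
      using \<eta>(2)[of x] nc that by (cases "x = t") (auto simp: dist_commute)
  qed (use that \<eta>(1) in \<open>auto simp: dist_commute\<close>)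
  then show ?thesis unfolding eventually_at using \<eta>(1) by blast
qed

lemma end_arc_noncrossing:
  assumes i: "i < ncomp D" and nc: "curve D i t \<notin> crossings D" and d: "d \<in> {1, -1}"
  shows "end_arc D (i, t) d = arc_at i t"
proof -
  have "\<forall>\<^sub>F e in at_right 0. arc_at i (t + d * e) = arc_at i t"
    using arc_at_locally_constant[OF i nc] filterlim_ray[OF d, of t] by (rule eventually_compose_filterlim)
  then have "\<forall>\<^sub>F e in at_right (0::real). end_arc D (i, t) d = arc_at i t"
    using eventually_arc_at[OF i d, of t] by eventually_elim simp
  then show ?thesis by (simp add: eventually_const)
qed

text \<open>The value -1 exchanges left and right and hence negates the colour. The existential
  makes the label a predicate on point sets; independence of the chosen parameter is the content of
  \<open>arc_label_arc_at\<close>.\<close>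

definition "arc_label \<omega> C \<longleftrightarrow>
  (\<exists>i<ncomp D. \<exists>t. curve D i t \<in> C \<and> ((\<omega> i = (1::int)) = left_even i t))"

text \<open>An arc is a connected set of points, not given as the image of an interval. Therefore
  the oriented left colour is treated as a function \<open>g\<close> of points:
  \<open>near_point_preimage\<close> takes points close in the plane to parameters close modulo 1,
  so \<open>g\<close> is locally constant on the arc and thus constant.\<close>

lemma arc_label_arc_at:
  assumes i: "i < ncomp D" and nc: "curve D i t \<notin> crossings D"
  shows "arc_label \<omega> (arc_at i t) \<longleftrightarrow> ((\<omega> i = 1) = left_even i t)"
proof -
  define g where "g z \<longleftrightarrow> (\<exists>i<ncomp D. \<exists>t. curve D i t = z \<and> ((\<omega> i = 1) = left_even i t))" for z
  have g: "g (curve D j s) \<longleftrightarrow> ((\<omega> j = 1) = left_even j s)"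
    if j: "j < ncomp D" "curve D j s \<notin> crossings D" for j s
  proof -
    have "k = j \<and> left_even k u = left_even j s" if k: "k < ncomp D" "curve D k u = curve D j s" for k u
    proof -
      have "k = j" "frac u = frac s" using same_strand[OF k(1) j(1) k(2)] j(2) k(2) by auto
      then obtain m where "u = s + of_int m" by (elim frac_eqE)
      then show ?thesis using left_even_add_int[OF j(1)] \<open>k = j\<close> by simp
    qed
    then show ?thesis unfolding g_def using j(1) by blast
  qed
  have "g z = g (curve D i t)" if z: "z \<in> arc_at i t" for z
  proof (rule connected_local_const[of "arc_at i t"])
    show "connected (arc_at i t)" by (simp add: arc_at_def)
    show "\<forall>a\<in>arc_at i t. \<forall>\<^sub>F b in at a within arc_at i t. g a = g b"
    proof
      have sub: "arc_at i t \<subseteq> shadow - crossings D"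
        unfolding arc_at_def by (rule connected_component_subset)
      fix a assume "a \<in> arc_at i t"
      then obtain j s where j: "j < ncomp D" "curve D j s \<notin> crossings D" and a: "a = curve D j s"
        using sub by (auto simp: shadow_def)
      obtain \<eta> where \<eta>: "\<eta> > 0" "\<And>x. \<bar>x - s\<bar> < \<eta> \<Longrightarrow> left_even j x = left_even j s"
        using left_even_locally_constant[OF j] by blast
      obtain r where r: "r > 0"
        "\<And>k x. k < ncomp D \<Longrightarrow> dist (curve D k x) a < r \<Longrightarrow> \<exists>x'. curve D k x' = a \<and> \<bar>x - x'\<bar> < \<eta>"
        using near_point_preimage[OF \<eta>(1)] by metis
      have "g a = g b" if b: "b \<in> arc_at i t" "dist b a < r" for b
      proof -
        obtain k x where k: "k < ncomp D" "curve D k x \<notin> crossings D" and bx: "b = curve D k x"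
          using b(1) sub by (auto simp: shadow_def)
        obtain x' where x': "curve D k x' = a" "\<bar>x - x'\<bar> < \<eta>" using r(2)[OF k(1)] b(2) bx by blast
        have "j = k" "frac x' = frac s" using same_strand[OF j(1) k(1), of s x'] a x'(1) j(2) by auto
        then obtain m where m: "x' = s + of_int m" by (elim frac_eqE)
        have "left_even j x = left_even j (x - of_int m)"
          using left_even_add_int[OF j(1), of "x - of_int m" m] by simp
        also have "\<dots> = left_even j s" using x'(2) m by (intro \<eta>(2)) (simp add: algebra_simps)
        finally show ?thesis using g[OF j] g[OF k] a bx \<open>j = k\<close> by simp
      qed
      then show "\<forall>\<^sub>F b in at a within arc_at i t. g a = g b"
        unfolding eventually_at using r(1) by blast
    qed
  qed (use z curve_in_arc_at[OF i nc] in auto)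
  moreover have "arc_label \<omega> (arc_at i t) \<longleftrightarrow> (\<exists>z\<in>arc_at i t. g z)"
    by (auto simp: arc_label_def g_def)
  ultimately show ?thesis using g[OF i nc] curve_in_arc_at[OF i nc] by blast
qed

section \<open>Labels around a crossing\<close>

lemma eventually_arc_label:
  assumes i: "i < ncomp D" and d: "d \<in> {1, -1}"
  shows "\<forall>\<^sub>F e in at_right 0. arc_label \<omega> (end_arc D (i, t) d) \<longleftrightarrow> ((\<omega> i = 1) = left_even i (t + d * e))"
  using eventually_arc_at[OF i d, of t] by eventually_elim (metis arc_label_arc_at[OF i])

lemma arc_label_crossing:
  assumes i: "i < ncomp D" and j: "j < ncomp D"
    and z: "curve D i t0 = z" "curve D j t1 = z" and ne: "\<not> (i = j \<and> frac t0 = frac t1)"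
    and a: "a \<in> {1, -1}" and b: "b \<in> {1, -1}"
  shows "arc_label \<omega> (end_arc D (i, t0) a) = arc_label \<omega> (end_arc D (j, t1) b) \<longleftrightarrow>
    ((\<omega> i = 1) = (\<omega> j = 1)) = (a \<noteq> b)"
proof -
  have "\<forall>\<^sub>F e in at_right (0::real). arc_label \<omega> (end_arc D (i, t0) a) = arc_label \<omega> (end_arc D (j, t1) b) \<longleftrightarrow>
    ((\<omega> i = 1) = (\<omega> j = 1)) = (a \<noteq> b)"
    using left_even_at_crossing[OF assms] eventually_arc_label[OF i a, of \<omega> t0]
      eventually_arc_label[OF j b, of \<omega> t1]
    by eventually_elim blast
  then show ?thesis by (simp add: eventually_const)
qed

lemma crossing_cases:
  assumes "z \<in> crossings D"
  obtains i t0 j t1 where "over D z = (i, t0)" "under D z = (j, t1)" "i < ncomp D" "j < ncomp D"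
    "curve D i t0 = z" "curve D j t1 = z" "\<not> (i = j \<and> frac t0 = frac t1)"
    "strands D z = {(i, t0), (j, t1)}"
proof -
  have S: "card (strands D z) = 2" "over D z \<in> strands D z"
    using diagram assms by (auto simp: classical_link_diagram_def)
  then obtain x y where xy: "strands D z = {x, y}" "x \<noteq> y" by (meson card_2_iff)
  have "\<exists>p. strands D z = {over D z, p} \<and> p \<noteq> over D z"
  proof (cases "over D z = x")
    case True
    then show ?thesis using xy by (intro exI[of _ y]) simp
  next
    case False
    then have "over D z = y" using xy S(2) by simp
    then show ?thesis using xy by (intro exI[of _ x]) (simp add: insert_commute)
  qed
  then obtain p where p: "strands D z = {over D z, p}" "p \<noteq> over D z" by blast
  then have "under D z = p" unfolding under_def by (intro the_equality) auto
  moreover obtain i t0 where o: "over D z = (i, t0)" by force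
  moreover obtain j t1 where u: "p = (j, t1)" by force
  moreover have "i < ncomp D" "curve D i t0 = z" "frac t0 = t0"
    using S(2) o by (auto simp: strands_def frac_eq)
  moreover have "p \<in> strands D z" using p by simp
  then have "j < ncomp D" "curve D j t1 = z" "frac t1 = t1"
    using u by (auto simp: strands_def frac_eq)
  ultimately show thesis using p by (intro that) auto
qed

lemma arc_label_over_under:
  assumes "z \<in> crossings D" "a \<in> {1, -1}" "b \<in> {1, -1}"
  shows "arc_label \<omega> (end_arc D (over D z) a) = arc_label \<omega> (end_arc D (under D z) b) \<longleftrightarrow>
    ((\<omega> (fst (over D z)) = 1) = (\<omega> (fst (under D z)) = 1)) = (a \<noteq> b)"
proof (rule crossing_cases[OF assms(1)])
  fix i t0 j t1
  assume *: "over D z = (i, t0)" "under D z = (j, t1)" "i < ncomp D" "j < ncomp D"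
    "curve D i t0 = z" "curve D j t1 = z" "\<not> (i = j \<and> frac t0 = frac t1)"
  show ?thesis using arc_label_crossing[OF *(3-7) assms(2,3)] * by simp
qed

text \<open>Both rays of the strand are compared with one fixed ray of the other strand: exactly one
  of them carries the same label as that ray.\<close>

lemma arc_label_flip:
  assumes i: "i < ncomp D" and z: "curve D i t \<in> crossings D"
  shows "arc_label \<omega> (end_arc D (i, t) 1) \<noteq> arc_label \<omega> (end_arc D (i, t) (-1))"
proof -
  obtain p q where pq: "p \<in> strands D (curve D i t)" "q \<in> strands D (curve D i t)" "p \<noteq> q"
    using z by (auto simp: crossings_def)
  then obtain x where x: "x \<in> strands D (curve D i t)" "x \<noteq> (i, frac t)" by metis
  obtain j s where "x = (j, s)" by force
  then have j: "j < ncomp D" "curve D j s = curve D i t" "(j, s) \<noteq> (i, frac t)" "0 \<le> s" "s < 1"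
    using x by (auto simp: strands_def)
  then have "\<not> (i = j \<and> frac t = frac s)" by (auto simp: frac_eq)
  then show ?thesis
    using arc_label_crossing[OF i j(1) refl j(2), of 1 1 \<omega>] arc_label_crossing[OF i j(1) refl j(2), of "-1" 1 \<omega>]
    by auto
qed

text \<open>The comparison with the colouring has no meaning at crossing parameters, where
  \<open>arc_at\<close> is empty. It is therefore followed on punctured neighbourhoods, and the
  crossings are bridged by \<open>locally_constant_except_points\<close>.\<close>

lemma flipping_labelling:
  assumes flip: "\<And>i t. i < ncomp D \<Longrightarrow> curve D i t \<in> crossings D \<Longrightarrow>
    l (end_arc D (i, t) 1) \<noteq> l (end_arc D (i, t) (-1))"
  obtains \<omega> where "\<omega> \<in> orientations D" "\<And>C. C \<in> arcs D \<Longrightarrow> l C = arc_label \<omega> C"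
proof -
  have "\<exists>b. \<forall>t. curve D i t \<notin> crossings D \<longrightarrow> (l (arc_at i t) = left_even i t) = b"
    if i: "i < ncomp D" for i
  proof -
    define P where "P t \<longleftrightarrow> (l (arc_at i t) = left_even i t)" for t
    \<comment> \<open>The labelling of the reference orientation; being a function of arcs, unlike
      \<open>left_even\<close>, it can be evaluated at the arcs leaving a crossing.\<close>
    define L where "L = arc_label (\<lambda>_. 1)"
    have P: "P t \<longleftrightarrow> (l (arc_at i t) = L (arc_at i t))" if "curve D i t \<notin> crossings D" for t
      unfolding L_def arc_label_arc_at[OF i that] by (simp add: P_def)
    have ex: "\<exists>b. \<forall>\<^sub>F x in at t. P x = b" for t
    proof -
      define b where "b \<longleftrightarrow> l (end_arc D (i, t) 1) = L (end_arc D (i, t) 1)"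
      \<comment> \<open>At a crossing both labellings flip, so their agreement or disagreement
        survives; elsewhere both ends belong to the same arc.\<close>
      have "(l (end_arc D (i, t) 1) = L (end_arc D (i, t) 1)) =
        (l (end_arc D (i, t) (-1)) = L (end_arc D (i, t) (-1)))"
      proof (cases "curve D i t \<in> crossings D")
        case True
        then show ?thesis using flip[OF i True] arc_label_flip[OF i True, of "\<lambda>_. 1"] unfolding L_def by argo
      next
        case False
        then show ?thesis using end_arc_noncrossing[OF i False] by simp
      qed
      then have b: "(l (end_arc D (i, t) d) = L (end_arc D (i, t) d)) = b" if "d \<in> {1, -1}" for d
        using that by (auto simp: b_def)
      have "\<forall>\<^sub>F x in at t. P x = b"
      proof (rule eventually_at_from_rays)
        fix d :: real assume d: "d \<in> {1, -1}"
        show "\<forall>\<^sub>F e in at_right 0. P (t + d * e) = b"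
          using eventually_arc_at[OF i d, of t] 
        proof eventually_elim
          case (elim e)
          then show ?case using P[of "t + d * e"] b[OF d] by simp
        qed
      qed
      then show ?thesis ..
    qed
    obtain b where b: "\<forall>t. \<forall>\<^sub>F x in at t. P x = b"
      using locally_constant_except_points[of P, OF ex] by (elim exE)
    \<comment> \<open>The value on the punctured neighbourhood is also taken at \<open>t\<close>,
      because off the crossings both the arc and \<open>left_even\<close> are locally
      constant.\<close>
    have "P t = b" if nc: "curve D i t \<notin> crossings D" for t
    proof -
      obtain \<eta> where \<eta>: "\<eta> > 0" "\<And>x. \<bar>x - t\<bar> < \<eta> \<Longrightarrow> left_even i x = left_even i t"
        using left_even_locally_constant[OF i nc] by blast
      have "\<forall>\<^sub>F x in at t. \<bar>x - t\<bar> < \<eta>" unfolding eventually_at dist_real_def using \<eta>(1) by blast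
      then have "\<forall>\<^sub>F x in at t. P t = b"
        using arc_at_locally_constant[OF i nc] spec[OF b, of t]
      proof eventually_elim
        case (elim x)
        then show ?case using \<eta>(2)[of x] by (simp add: P_def)
      qed
      then show ?thesis by (simp add: eventually_const)
    qed
    then show ?thesis unfolding P_def by blast
  qed
  then have "\<exists>b. \<forall>i. i < ncomp D \<longrightarrow> (\<forall>t. curve D i t \<notin> crossings D \<longrightarrow> (l (arc_at i t) = left_even i t) = b i)"
    by (intro choice) blast
  then obtain b where b: "\<And>i t. i < ncomp D \<Longrightarrow> curve D i t \<notin> crossings D \<Longrightarrow>
    (l (arc_at i t) = left_even i t) = b i" by blast
  define \<omega> where "\<omega> = restrict (\<lambda>i. if b i then 1 else -1 :: int) {..<ncomp D}"
  show thesis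
  proof (rule that)
    show "\<omega> \<in> orientations D" by (auto simp: \<omega>_def orientations_def)
    fix C assume "C \<in> arcs D"
    then obtain i t where it: "i < ncomp D" "curve D i t \<notin> crossings D" "C = arc_at i t" by (rule arcsE)
    have "(\<omega> i = 1) = b i" using it(1) by (simp add: \<omega>_def)
    then show "l C = arc_label \<omega> C"
      using b[OF it(1,2)] arc_label_arc_at[OF it(1,2), of \<omega>] it(3) by auto
  qed
qed

text \<open>Every component has a parameter off the crossings, and the label of the arc there
  reveals the orientation of the component.\<close>

lemma arc_label_inj:
  assumes "\<omega> \<in> orientations D" "\<omega>' \<in> orientations D"
    and eq: "\<And>C. C \<in> arcs D \<Longrightarrow> arc_label \<omega> C = arc_label \<omega>' C"
  shows "\<omega> = \<omega>'"
proof (rule PiE_ext)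
  show "\<omega> \<in> {..<ncomp D} \<rightarrow>\<^sub>E {1, -1}" "\<omega>' \<in> {..<ncomp D} \<rightarrow>\<^sub>E {1, -1}"
    using assms by (auto simp: orientations_def)
  fix i assume "i \<in> {..<ncomp D}"
  then have i: "i < ncomp D" by simp
  obtain t where t: "curve D i t \<notin> crossings D"
    using eventually_noncrossing[OF i, of 0] eventually_happens' trivial_limit_at by blast
  have "(\<omega> i = 1) = (\<omega>' i = 1)"
    using eq[OF arc_at_arcs[OF i t]] arc_label_arc_at[OF i t] by auto
  moreover have "\<omega> i \<in> {1, -1}" "\<omega>' i \<in> {1, -1}" using assms i by (auto simp: orientations_def)
  ultimately show "\<omega> i = \<omega>' i" by auto
qed

section \<open>Crossing signs and smoothings\<close>

lemma over_under_transversal: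
  assumes "z \<in> crossings D"
  shows "cross2 (velocity D (over D z)) (velocity D (under D z)) \<noteq> 0"
  by (rule crossing_cases[OF assms])
    (auto simp: velocity_def simp flip: vel_def intro: crossing_transversal[THEN notE])

lemma over_under_component:
  assumes "z \<in> crossings D"
  shows "fst (over D z) < ncomp D" "fst (under D z) < ncomp D"
  by (rule crossing_cases[OF assms]; simp)+

lemma crossing_sign_eq_1:
  assumes z: "z \<in> crossings D" and \<omega>: "\<omega> \<in> orientations D"
  shows "crossing_sign D \<omega> z = 1 \<longleftrightarrow>
    (\<omega> (fst (over D z)) = 1) = (\<omega> (fst (under D z)) = 1) =
    (cross2 (velocity D (over D z)) (velocity D (under D z)) > 0)"
proof -
  define x y where "x = \<omega> (fst (over D z))" and "y = \<omega> (fst (under D z))"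
  have xy: "x \<in> {1, -1}" "y \<in> {1, -1}"
    using \<omega> over_under_component[OF z] by (auto simp: orientations_def x_def y_def)
  have "cross2 (direction D \<omega> (over D z)) (direction D \<omega> (under D z)) =
    of_int (x * y) * cross2 (velocity D (over D z)) (velocity D (under D z))"
    by (simp add: direction_def x_def y_def cross2_eq algebra_simps)
  then show ?thesis
    using xy over_under_transversal[OF z] unfolding crossing_sign_def x_def[symmetric] y_def[symmetric]
    by auto
qed

text \<open>Both strands are reversed together, and the determinant is bilinear.\<close>

lemma crossing_sign_self:
  assumes "z \<in> crossings D" "\<omega> \<in> orientations D" "\<omega>' \<in> orientations D"
    and "fst (over D z) = fst (under D z)"
  shows "crossing_sign D \<omega> z = crossing_sign D \<omega>' z"
proof -
  have "crossing_sign D \<omega> z = 1 \<longleftrightarrow> crossing_sign D \<omega>' z = 1"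
    using assms by (simp add: crossing_sign_eq_1)
  then show ?thesis by (auto simp: crossing_sign_def split: if_splits)
qed

text \<open>For every orientation a smoothing joins either only rays of equal label or only rays of
  distinct label. Label agreement compares \<open>a \<noteq> b\<close> with the relative orientation
  of the strands, and the crossing sign compares that relative orientation with the sign of the
  determinant; the relative orientation cancels.\<close>

lemma smoothing_arcs_iff:
  assumes z: "z \<in> crossings D" and \<omega>: "\<omega> \<in> orientations D"
  shows "(a, b) \<in> smoothing_arcs D z m \<longleftrightarrow> a \<in> {1, -1} \<and> b \<in> {1, -1} \<and>
    ((m = A_smoothing \<longleftrightarrow> crossing_sign D \<omega> z = 1) \<longleftrightarrow>
      arc_label \<omega> (end_arc D (over D z) a) = arc_label \<omega> (end_arc D (under D z) b))"
proof (cases "a \<in> {1, -1} \<and> b \<in> {1, -1}")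
  case True
  then have ab: "a \<in> {1, -1}" "b \<in> {1, -1}" by auto
  define K where "K = cross2 (velocity D (over D z)) (velocity D (under D z))"
  have "K \<noteq> 0" using over_under_transversal[OF z] by (simp add: K_def)
  \<comment> \<open>The A-smoothing requires \<open>a * b * K < 0\<close>, which is the parity
    condition on the right.\<close>
  have "(a, b) \<in> smoothing_arcs D z m \<longleftrightarrow> (m = A_smoothing \<longleftrightarrow> (a \<noteq> b \<longleftrightarrow> K > 0))"
    using ab \<open>K \<noteq> 0\<close> unfolding smoothing_arcs_def
    by (cases m) (auto simp: cross2_algebra K_def[symmetric] Let_def)
  then show ?thesis
    using arc_label_over_under[OF z ab, of \<omega>] crossing_sign_eq_1[OF z \<omega>] ab
    unfolding K_def by blast
next
  case False
  then show ?thesis by (auto simp: smoothing_arcs_def)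
qed

end

section \<open>Properly labeled states and orientations\<close>

lemma A_pow_0: "A_pow 0 = 1"
  by (simp add: A_pow_def)

lemma A_pow_add: "A_pow (a + b) = A_pow a * A_pow b"
  by (simp add: A_pow_def Poly_Mapping.mult_single)

lemma A_pow_sum: "A_pow (sum f X) = (\<Prod>x\<in>X. A_pow (f x))"
  by (induction X rule: infinite_finite_induct) (simp_all add: A_pow_0 A_pow_add)

lemma equiv_same_loop: "equiv UNIV (same_loop D s)"
  unfolding same_loop_def
  by (intro equivI refl_rtrancl sym_rtrancl sym_Un_converse trans_rtrancl) auto

lemma same_loop_class_eq: "(C, C') \<in> same_loop D s \<Longrightarrow> same_loop D s `` {C} = same_loop D s `` {C'}"
  by (rule equiv_class_eq[OF equiv_same_loop])

lemma joined_subset_same_loop: "joined D s \<subseteq> same_loop D s"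
  unfolding same_loop_def by blast

lemma same_loop_invariant:
  assumes "(C, C') \<in> same_loop D s" and "\<And>C C'. (C, C') \<in> joined D s \<Longrightarrow> l C = l C'"
  shows "l C = l C'"
  using assms(1) unfolding same_loop_def
  by (induction rule: rtrancl_induct) (use assms(2) in fastforce)+

context link begin

definition "oriented_state \<omega> =
  restrict (\<lambda>z. if crossing_sign D \<omega> z = 1 then A_smoothing else B_smoothing) (crossings D)"

text \<open>All arcs of a loop carry the same label by \<open>arc_label_same_loop\<close>, so any
  one of them may be consulted. The restriction provides the extensionality demanded of labelings of
  loops.\<close>

definition "loop_labels \<omega> =
  restrict (\<lambda>K. if \<exists>C\<in>K. arc_label \<omega> C then 1 else 0 :: nat) (loops D (oriented_state \<omega>))"

lemma end_arc_over_under_in_arcs: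
  assumes "z \<in> crossings D" "a \<in> {1, -1}"
  shows "end_arc D (over D z) a \<in> arcs D" "end_arc D (under D z) a \<in> arcs D"
  using end_arc_in_arcs[OF over_under_component(1)[OF assms(1)] assms(2), of "snd (over D z)"]
    end_arc_in_arcs[OF over_under_component(2)[OF assms(1)] assms(2), of "snd (under D z)"] by auto

lemma arc_label_over_flip:
  assumes "z \<in> crossings D" "a \<in> {1, -1}"
  shows "arc_label \<omega> (end_arc D (over D z) (-a)) \<noteq> arc_label \<omega> (end_arc D (over D z) a)"
proof (rule crossing_cases[OF assms(1)])
  fix i t0 assume "over D z = (i, t0)" "i < ncomp D" "curve D i t0 = z"
  then show ?thesis using arc_label_flip[of i t0 \<omega>] assms by auto
qed

lemma smoothing_arcs_oriented_state:
  assumes "z \<in> crossings D" "\<omega> \<in> orientations D"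
  shows "(a, b) \<in> smoothing_arcs D z (oriented_state \<omega> z) \<longleftrightarrow> a \<in> {1, -1} \<and> b \<in> {1, -1} \<and>
    arc_label \<omega> (end_arc D (over D z) a) = arc_label \<omega> (end_arc D (under D z) b)"
  using assms by (simp add: smoothing_arcs_iff[OF assms] oriented_state_def)

text \<open>A smoothing fixes the sign of the product \<open>a * b\<close>, which leaves two
  antipodal choices.\<close>

lemma smoothing_arcs_opposite:
  assumes "(a, b) \<in> smoothing_arcs D z m" "(a', b') \<in> smoothing_arcs D z m" "(a, b) \<noteq> (a', b')"
  shows "a' = - a \<and> b' = - b"
  using assms unfolding smoothing_arcs_def
  by (cases m) (auto simp: cross2_algebra Let_def)

lemma arc_label_same_loop:
  assumes \<omega>: "\<omega> \<in> orientations D" and "(C, C') \<in> same_loop D (oriented_state \<omega>)"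
  shows "arc_label \<omega> C = arc_label \<omega> C'"
  using assms(2)
proof (rule same_loop_invariant)
  fix C C' assume "(C, C') \<in> joined D (oriented_state \<omega>)"
  then show "arc_label \<omega> C = arc_label \<omega> C'"
    using smoothing_arcs_oriented_state[OF _ \<omega>] by (auto simp: joined_def)
qed

lemma loop_in_loops: "C \<in> arcs D \<Longrightarrow> same_loop D s `` {C} \<in> loops D s"
  unfolding loops_def by (rule quotientI)

lemma loop_labels_class:
  assumes \<omega>: "\<omega> \<in> orientations D" and C: "C \<in> arcs D"
  shows "loop_labels \<omega> (same_loop D (oriented_state \<omega>) `` {C}) = (if arc_label \<omega> C then 1 else 0)"
proof -
  have "(C, C) \<in> same_loop D (oriented_state \<omega>)" by (simp add: same_loop_def)
  then have "(\<exists>C'\<in>same_loop D (oriented_state \<omega>) `` {C}. arc_label \<omega> C') = arc_label \<omega> C"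
    using arc_label_same_loop[OF \<omega>] by blast
  then show ?thesis using loop_in_loops[OF C] by (simp add: loop_labels_def)
qed

text \<open>The two arcs of a smoothing start on opposite over-rays, and these carry distinct labels
  by \<open>arc_label_over_flip\<close>.\<close>

lemma oriented_state_proper:
  assumes \<omega>: "\<omega> \<in> orientations D"
  shows "(oriented_state \<omega>, loop_labels \<omega>) \<in> proper_labeled_states D"
proof -
  have "properly_labeled D (oriented_state \<omega>) (loop_labels \<omega>)"
    unfolding properly_labeled_def
  proof (intro ballI impI)
    fix z c c' assume z: "z \<in> crossings D" and "c \<noteq> c'"
      and c: "c \<in> smoothing_arcs D z (oriented_state \<omega> z)" "c' \<in> smoothing_arcs D z (oriented_state \<omega> z)"
    obtain a b where ab: "c = (a, b)" by force
    have c': "c' = (-a, -b)"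
      using smoothing_arcs_opposite[of a b z _ "fst c'" "snd c'"] c \<open>c \<noteq> c'\<close> ab by (metis prod.collapse)
    have a: "a \<in> {1, -1}" "- a \<in> {1, -1}" using c(1) unfolding ab smoothing_arcs_def by auto
    show "loop_labels \<omega> (loop_through D (oriented_state \<omega>) z c) \<noteq>
      loop_labels \<omega> (loop_through D (oriented_state \<omega>) z c')"
      using arc_label_over_flip[OF z a(1), of \<omega>]
        loop_labels_class[OF \<omega> end_arc_over_under_in_arcs(1)[OF z a(1)]]
        loop_labels_class[OF \<omega> end_arc_over_under_in_arcs(1)[OF z a(2)]]
      by (simp add: loop_through_def ab c')
  qed
  moreover have "oriented_state \<omega> \<in> states D" by (simp add: oriented_state_def states_def)
  moreover have "loop_labels \<omega> \<in> loops D (oriented_state \<omega>) \<rightarrow>\<^sub>E {0, 1}"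
    by (auto simp: loop_labels_def)
  ultimately show ?thesis by (simp add: proper_labeled_states_def)
qed

lemma inj_oriented_state: "inj_on (\<lambda>\<omega>. (oriented_state \<omega>, loop_labels \<omega>)) (orientations D)"
proof (rule inj_onI)
  fix \<omega> \<omega>' assume \<omega>: "\<omega> \<in> orientations D" "\<omega>' \<in> orientations D"
    and eq: "(oriented_state \<omega>, loop_labels \<omega>) = (oriented_state \<omega>', loop_labels \<omega>')"
  show "\<omega> = \<omega>'"
  proof (rule arc_label_inj[OF \<omega>])
    fix C assume C: "C \<in> arcs D"
    have "(if arc_label \<omega> C then 1 else 0 :: nat) = (if arc_label \<omega>' C then 1 else 0)"
      using loop_labels_class[OF \<omega>(1) C] loop_labels_class[OF \<omega>(2) C] eq by simp
    then show "arc_label \<omega> C = arc_label \<omega>' C" by (auto split: if_splits)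
  qed
qed

text \<open>The loop labels are pulled back to a predicate \<open>lam\<close> on arcs. Properness
  makes it flip at every passage, so \<open>flipping_labelling\<close> supplies an orientation; both
  the smoothings and the loop labels can be recovered from it.\<close>

lemma proper_labeled_state_oriented:
  assumes "(s, l) \<in> proper_labeled_states D"
  obtains \<omega> where "\<omega> \<in> orientations D" "s = oriented_state \<omega>" "l = loop_labels \<omega>"
proof -
  have s: "s \<in> states D" and l: "l \<in> loops D s \<rightarrow>\<^sub>E {0, 1}" and proper: "properly_labeled D s l"
    using assms by (auto simp: proper_labeled_states_def)
  define lam where "lam C \<longleftrightarrow> l (same_loop D s `` {C}) = 1" for C
  have l01: "l (same_loop D s `` {C}) = (if lam C then 1 else 0)" if "C \<in> arcs D" for C
    using PiE_mem[OF l loop_in_loops[OF that]] by (auto simp: lam_def)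
  have join: "lam (end_arc D (over D z) a) = lam (end_arc D (under D z) b)"
    if z: "z \<in> crossings D" and ab: "(a, b) \<in> smoothing_arcs D z (s z)" for z a b
  proof -
    have "(end_arc D (over D z) a, end_arc D (under D z) b) \<in> joined D s"
      using that by (auto simp: joined_def)
    then have "same_loop D s `` {end_arc D (over D z) a} = same_loop D s `` {end_arc D (under D z) b}"
      using joined_subset_same_loop by (intro same_loop_class_eq) auto
    then show ?thesis by (simp add: lam_def)
  qed
  have ex: "\<exists>b. (1, b) \<in> smoothing_arcs D z (s z) \<and> (-1, -b) \<in> smoothing_arcs D z (s z) \<and> b \<in> {1, -1}"
    if z: "z \<in> crossings D" for z
  proof -
    have "(1, 1) \<in> smoothing_arcs D z (s z) \<and> (-1, -1) \<in> smoothing_arcs D z (s z) \<or>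
      (1, -1) \<in> smoothing_arcs D z (s z) \<and> (-1, 1) \<in> smoothing_arcs D z (s z)"
      using over_under_transversal[OF z] unfolding smoothing_arcs_def
      by (cases "s z") (auto simp: cross2_algebra Let_def)
    then show ?thesis by auto
  qed
  \<comment> \<open>\<open>loop_through\<close> looks only at over-rays, so properness speaks about
    these; the joined pairs carry the conclusion over to the under-rays.\<close>
  have flip: "lam (end_arc D p 1) \<noteq> lam (end_arc D p (-1))"
    if z: "z \<in> crossings D" and p: "p \<in> {over D z, under D z}" for z p
  proof -
    obtain b where b: "(1, b) \<in> smoothing_arcs D z (s z)" "(-1, -b) \<in> smoothing_arcs D z (s z)" "b \<in> {1, -1}"
      using ex[OF z] by auto
    have "l (loop_through D s z (1, b)) \<noteq> l (loop_through D s z (-1, -b))"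
      using proper b z unfolding properly_labeled_def by fastforce
    then have "lam (end_arc D (over D z) 1) \<noteq> lam (end_arc D (over D z) (-1))"
      using l01 end_arc_over_under_in_arcs(1)[OF z] by (auto simp: loop_through_def split: if_splits)
    then show ?thesis using join[OF z b(1)] join[OF z b(2)] b(3) p by auto
  qed
  have flip': "lam (end_arc D (i, t) 1) \<noteq> lam (end_arc D (i, t) (-1))"
    if i: "i < ncomp D" and z: "curve D i t \<in> crossings D" for i t
  proof (rule crossing_cases[OF z])
    fix j t0 k t1
    assume "over D (curve D i t) = (j, t0)" "under D (curve D i t) = (k, t1)"
      "strands D (curve D i t) = {(j, t0), (k, t1)}"
    then have "(i, frac t) \<in> {over D (curve D i t), under D (curve D i t)}"
      using strand_frac[OF i refl, of t] by simp
    from flip[OF z this] show ?thesis by (simp add: end_arc_frac[OF i])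
  qed
  obtain \<omega> where \<omega>: "\<omega> \<in> orientations D" and lab: "\<And>C. C \<in> arcs D \<Longrightarrow> lam C = arc_label \<omega> C"
    using flipping_labelling[of lam, OF flip'] by blast
  have s_eq: "s = oriented_state \<omega>"
  proof (rule PiE_ext)
    show "s \<in> crossings D \<rightarrow>\<^sub>E UNIV" "oriented_state \<omega> \<in> crossings D \<rightarrow>\<^sub>E UNIV"
      using s by (auto simp: states_def oriented_state_def)
    fix z assume z: "z \<in> crossings D"
    obtain b where b: "(1, b) \<in> smoothing_arcs D z (s z)" "b \<in> {1, -1}" using ex[OF z] by auto
    \<comment> \<open>A single smoothing arc whose two ends have equal labels already decides the
      smoothing, by \<open>smoothing_arcs_iff\<close>.\<close>
    have "arc_label \<omega> (end_arc D (over D z) 1) = arc_label \<omega> (end_arc D (under D z) b)"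
      using join[OF z b(1)] lab end_arc_over_under_in_arcs[OF z] b(2) by auto
    then have "s z = A_smoothing \<longleftrightarrow> crossing_sign D \<omega> z = 1"
      using smoothing_arcs_iff[OF z \<omega>, of 1 b "s z"] b(1) by blast
    then show "s z = oriented_state \<omega> z"
      using z by (cases "s z") (auto simp: oriented_state_def)
  qed
  have "l = loop_labels \<omega>"
  proof (rule PiE_ext)
    show "l \<in> loops D s \<rightarrow>\<^sub>E {0, 1}" by fact
    show "loop_labels \<omega> \<in> loops D s \<rightarrow>\<^sub>E {0, 1}"
      using oriented_state_proper[OF \<omega>] s_eq by (simp add: proper_labeled_states_def)
    fix K assume "K \<in> loops D s"
    then obtain C where C: "C \<in> arcs D" "K = same_loop D s `` {C}"
      unfolding loops_def by (rule quotientE)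
    then show "l K = loop_labels \<omega> K"
      using l01[OF C(1)] lab[OF C(1)] loop_labels_class[OF \<omega> C(1)] s_eq by simp
  qed
  then show thesis using that \<omega> s_eq by blast
qed

section \<open>Evaluation of the bracket and differences of writhes\<close>

lemma state_weight_oriented:
  "state_weight D (oriented_state \<omega>) = A_pow (writhe D \<omega>)"
proof -
  have "vertex_weight (oriented_state \<omega> z) = A_pow (crossing_sign D \<omega> z)" if "z \<in> crossings D" for z
    using that by (auto simp: oriented_state_def vertex_weight_def crossing_sign_def)
  then show ?thesis by (simp add: state_weight_def writhe_def A_pow_sum)
qed

lemma binary_bracket_eq: "binary_bracket D = (\<Sum>\<omega>\<in>orientations D. A_pow (writhe D \<omega>))"
proof -
  have "bij_betw (\<lambda>\<omega>. (oriented_state \<omega>, loop_labels \<omega>)) (orientations D) (proper_labeled_states D)"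
    unfolding bij_betw_def
  proof (intro conjI inj_oriented_state equalityI subsetI)
    fix x assume "x \<in> proper_labeled_states D"
    then show "x \<in> (\<lambda>\<omega>. (oriented_state \<omega>, loop_labels \<omega>)) ` orientations D"
      by (cases x) (auto elim!: proper_labeled_state_oriented)
  qed (use oriented_state_proper in auto)
  then have "(\<Sum>\<omega>\<in>orientations D. case (oriented_state \<omega>, loop_labels \<omega>) of (s, l) \<Rightarrow> state_weight D s) =
    binary_bracket D"
    unfolding binary_bracket_def by (rule sum.reindex_bij_betw)
  then show ?thesis by (simp add: state_weight_oriented)
qed

lemma Inv_eq: "Inv D \<omega>\<^sub>0 = (\<Sum>\<omega>\<in>orientations D. A_pow (writhe D \<omega> - writhe D \<omega>\<^sub>0))"
  by (simp add: Inv_def binary_bracket_eq sum_distrib_left flip: A_pow_add)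

text \<open>Self-crossings have the same sign for all orientations and cancel. The remaining
  crossings are grouped by their pair of components, and the factor 2 undoes the halving in
  \<open>linking_number\<close>.\<close>

lemma writhe_diff_linking:
  assumes \<omega>: "\<omega> \<in> orientations D" "\<omega>\<^sub>0 \<in> orientations D"
  shows "rat_of_int (writhe D \<omega> - writhe D \<omega>\<^sub>0) =
    2 * (\<Sum>(i, j) \<in> {(i, j). i < j \<and> j < ncomp D}. linking_number D \<omega> i j - linking_number D \<omega>\<^sub>0 i j)"
proof -
  define d where "d z = crossing_sign D \<omega> z - crossing_sign D \<omega>\<^sub>0 z" for z
  \<comment> \<open>Either component of a pair may be the upper one at a given crossing; sorting
    selects the representative with \<open>i < j\<close>.\<close>
  define c where "c z = (min (fst (over D z)) (fst (under D z)), max (fst (over D z)) (fst (under D z)))" for z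
  define S where "S = {z \<in> crossings D. fst (over D z) \<noteq> fst (under D z)}"
  define T where "T = {(i, j). i < j \<and> j < ncomp D}"
  have "finite T" unfolding T_def by (rule finite_subset[of _ "{..<ncomp D} \<times> {..<ncomp D}"]) auto
  have "c ` S \<subseteq> T"
    using over_under_component by (auto simp: S_def c_def T_def min_def max_def)
  have "writhe D \<omega> - writhe D \<omega>\<^sub>0 = sum d (crossings D)"
    by (simp add: writhe_def d_def sum_subtractf)
  also have "\<dots> = sum d S"
  proof (rule sum.mono_neutral_right)
    show "\<forall>z\<in>crossings D - S. d z = 0"
      using crossing_sign_self[OF _ \<omega>] by (simp add: S_def d_def)
  qed (auto simp: S_def finite_crossings)
  also have "\<dots> = (\<Sum>p\<in>T. sum d {z \<in> S. c z = p})"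
    by (rule sum.group[symmetric]) (use finite_crossings \<open>finite T\<close> \<open>c ` S \<subseteq> T\<close> in \<open>auto simp: S_def\<close>)
  finally have "rat_of_int (writhe D \<omega> - writhe D \<omega>\<^sub>0) = (\<Sum>p\<in>T. rat_of_int (sum d {z \<in> S. c z = p}))"
    by simp
  also have "\<dots> = (\<Sum>p\<in>T. 2 * (case p of (i, j) \<Rightarrow> linking_number D \<omega> i j - linking_number D \<omega>\<^sub>0 i j))"
  proof (rule sum.cong[OF refl])
    fix p assume "p \<in> T"
    then obtain i j where p: "p = (i, j)" "i < j" by (auto simp: T_def)
    have *: "x \<noteq> y \<and> (min x y, max x y) = (i, j) \<longleftrightarrow> {x, y} = {i, j}" for x y
      using p(2) by (auto simp: doubleton_eq_iff min_def max_def)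
    have eq: "{z \<in> S. c z = (i, j)} = {z \<in> crossings D. {fst (over D z), fst (under D z)} = {i, j}}"
      unfolding S_def c_def *[symmetric] by blast
    show "rat_of_int (sum d {z \<in> S. c z = p}) =
      2 * (case p of (i, j) \<Rightarrow> linking_number D \<omega> i j - linking_number D \<omega>\<^sub>0 i j)"
      unfolding eq p(1) prod.case linking_number_def d_def sum_subtractf by (simp add: field_simps)
  qed
  finally show ?thesis by (simp add: T_def sum_distrib_left)
qed

text \<open>With one component every crossing is a self-crossing.\<close>

lemma knot_writhe:
  assumes "ncomp D = 1" "\<omega> \<in> orientations D" "\<omega>' \<in> orientations D"
  shows "writhe D \<omega> = writhe D \<omega>'"
  unfolding writhe_def
  using over_under_component assms by (intro sum.cong refl crossing_sign_self) auto

end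

theorem theorem1:
  shows
    "(\<forall>K. classical_knot_diagram K \<longrightarrow>
       (\<forall>\<omega> \<in> orientations K. \<forall>\<omega>' \<in> orientations K. writhe K \<omega> = writhe K \<omega>') \<and>
       (\<forall>\<omega> \<in> orientations K. binary_bracket K = 2 * A_pow (writhe K \<omega>) \<and> Inv K \<omega> = 2)) \<and>
     (\<forall>L. classical_link_diagram L \<longrightarrow>
       binary_bracket L = (\<Sum>\<omega> \<in> orientations L. A_pow (writhe L \<omega>)) \<and>
       (\<forall>\<omega>\<^sub>0 \<in> orientations L.
          Inv L \<omega>\<^sub>0 = (\<Sum>\<omega> \<in> orientations L. A_pow (writhe L \<omega> - writhe L \<omega>\<^sub>0)) \<and>
          (\<forall>\<omega> \<in> orientations L.
             rat_of_int (writhe L \<omega> - writhe L \<omega>\<^sub>0) =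
               2 * (\<Sum>(i, j) \<in> {(i, j). i < j \<and> j < ncomp L}.
                      linking_number L \<omega> i j - linking_number L \<omega>\<^sub>0 i j))))"
proof (intro conjI allI impI)
  fix K assume "classical_knot_diagram K"
  then interpret link K by unfold_locales (simp add: classical_knot_diagram_def)
  have one: "ncomp K = 1" using \<open>classical_knot_diagram K\<close> by (simp add: classical_knot_diagram_def)
  show same: "\<forall>\<omega> \<in> orientations K. \<forall>\<omega>' \<in> orientations K. writhe K \<omega> = writhe K \<omega>'"
    using knot_writhe[OF one] by blast
  have card: "card (orientations K) = 2"
    by (simp add: orientations_def one card_PiE)
  show "\<forall>\<omega> \<in> orientations K. binary_bracket K = 2 * A_pow (writhe K \<omega>) \<and> Inv K \<omega> = 2"
  proof
    fix \<omega> assume \<omega>: "\<omega> \<in> orientations K"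
    have "binary_bracket K = (\<Sum>\<omega>'\<in>orientations K. A_pow (writhe K \<omega>))"
      unfolding binary_bracket_eq by (rule sum.cong[OF refl]) (use same \<omega> in metis)
    then have "binary_bracket K = 2 * A_pow (writhe K \<omega>)" by (simp add: card)
    moreover from this have "Inv K \<omega> = 2 * (A_pow (- writhe K \<omega>) * A_pow (writhe K \<omega>))"
      by (simp add: Inv_def ac_simps)
    then have "Inv K \<omega> = 2" by (simp add: A_pow_0 flip: A_pow_add)
    ultimately show "binary_bracket K = 2 * A_pow (writhe K \<omega>) \<and> Inv K \<omega> = 2" ..
  qed
next
  fix L assume "classical_link_diagram L"
  then interpret link L by unfold_locales
  show "binary_bracket L = (\<Sum>\<omega> \<in> orientations L. A_pow (writhe L \<omega>))"
    by (rule binary_bracket_eq)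
  show "\<forall>\<omega>\<^sub>0 \<in> orientations L.
          Inv L \<omega>\<^sub>0 = (\<Sum>\<omega> \<in> orientations L. A_pow (writhe L \<omega> - writhe L \<omega>\<^sub>0)) \<and>
          (\<forall>\<omega> \<in> orientations L.
             rat_of_int (writhe L \<omega> - writhe L \<omega>\<^sub>0) =
               2 * (\<Sum>(i, j) \<in> {(i, j). i < j \<and> j < ncomp L}.
                      linking_number L \<omega> i j - linking_number L \<omega>\<^sub>0 i j))"
    using Inv_eq writhe_diff_linking by blast
qed

end
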